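(* Let $\Gamma$ be a finite simplicial graph and let $\Gamma^{\mathrm{e}}$ be its extension graph. Then there exists an infinite sequence $\{\Gamma_i\}_{i\ge 0}$ of finite induced subgraphs of $\Gamma^{\mathrm{e}}$ such that for each $i\ge 0$ the graph $\Gamma_{i+1}$ is (isomorphic to) the double of $\Gamma_i$ along the star of some vertex of $\Gamma_i$, and such that every finite induced subgraph of $\Gamma^{\mathrm{e}}$ is isomorphic to an induced subgraph of some $\Gamma_i$.
   Context: For a finite simplicial graph $\Gamma$ with vertex set $V$, the right-angled Artin group is $A(\Gamma)=\langle V \mid [a,b]=1 \text{ for } \{a,b\}\in E(\Gamma)\rangle$. For $u,w\in A(\Gamma)$ write $u^w=w^{-1}uw$, and for subsets $U,W\subseteq A(\Gamma)$ write $U^W=\{u^w: u\in U, w\in W\}$. Put $V^{\mathrm{e}}=V^{A(\Gamma)}$. The extension graph $\Gamma^{\mathrm{e}}$ is the simplicial graph with vertex set $V^{\mathrm{e}}$ in which two distinct vertices $x,y$ are adjacent iff $[x,y]=1$ in $A(\Gamma)$. For a graph $X$ and a vertex $v$, the star $\mathrm{st}_X(v)$ is the set of vertices equal or adjacent to $v$. The double of $X$ along the star of $v$ is the graph $Y$ defined as follows: take sets $S_0,S_1$ with bijections $\rho_i: S_i\to V(X)\setminus \mathrm{st}(v)$; set $V(Y)=S_0\sqcup S_1\sqcup \mathrm{st}(v)$, and $\{a,b\}\in E(Y)$ iff one of: (i) $a,b\in S_i$ and $\{\rho_i(a),\rho_i(b)\}\in E(X)$ for some $i\in\{0,1\}$;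 (ii) $a\in S_i$, $b\in \mathrm{st}(v)$ and $\{\rho_i(a),b\}\in E(X)$ for some $i\in\{0,1\}$; (iii) $a,b\in\mathrm{st}(v)$ and $\{a,b\}\in E(X)$. *)

theory Defs
  imports Main
begin

text \<open>Words over the generators: a letter is a pair (v, True) = v or (v, False) = v^-1.\<close>
type_synonym 'v letter = "'v \<times> bool"

definition linv :: "'v letter \<Rightarrow> 'v letter" where
  "linv x = (fst x, \<not> snd x)"

definition winv :: "'v letter list \<Rightarrow> 'v letter list" where
  "winv w = rev (map linv w)"

inductive_set raag_step :: "'v set \<Rightarrow> ('v \<Rightarrow> 'v \<Rightarrow> bool) \<Rightarrow> ('v letter list \<times> 'v letter list) set"
  for V :: "'v set" and E :: "'v \<Rightarrow> 'v \<Rightarrow> bool" where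
  cancel: "fst x \<in> V \<Longrightarrow> (u @ [x, linv x] @ w, u @ w) \<in> raag_step V E"
| comm: "fst x \<in> V \<Longrightarrow> fst y \<in> V \<Longrightarrow> E (fst x) (fst y) \<Longrightarrow>
           (u @ [x, y] @ w, u @ [y, x] @ w) \<in> raag_step V E"

definition raag_eq :: "'v set \<Rightarrow> ('v \<Rightarrow> 'v \<Rightarrow> bool) \<Rightarrow> ('v letter list \<times> 'v letter list) set" where
  "raag_eq V E = (raag_step V E \<union> (raag_step V E)\<inverse>)\<^sup>*"

definition raag_elem :: "'v set \<Rightarrow> ('v \<Rightarrow> 'v \<Rightarrow> bool) \<Rightarrow> 'v letter list \<Rightarrow> 'v letter list set" where
  "raag_elem V E w = {u. (w, u) \<in> raag_eq V E}"

definition ext_vertices :: "'v set \<Rightarrow> ('v \<Rightarrow> 'v \<Rightarrow> bool) \<Rightarrow> 'v letter list set set" where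
  "ext_vertices V E = {raag_elem V E (winv w @ [(v, True)] @ w) | v w. v \<in> V \<and> w \<in> lists (V \<times> UNIV)}"

definition ext_adj :: "'v set \<Rightarrow> ('v \<Rightarrow> 'v \<Rightarrow> bool) \<Rightarrow> 'v letter list set \<Rightarrow> 'v letter list set \<Rightarrow> bool" where
  "ext_adj V E x y = (x \<noteq> y \<and> (\<exists>a\<in>x. \<exists>b\<in>y. (a @ b, b @ a) \<in> raag_eq V E))"

text \<open>Graphs are given by a vertex set and an adjacency predicate (considered on the vertex set).\<close>
definition graph_iso :: "'a set \<Rightarrow> ('a \<Rightarrow> 'a \<Rightarrow> bool) \<Rightarrow> 'b set \<Rightarrow> ('b \<Rightarrow> 'b \<Rightarrow> bool) \<Rightarrow> bool" where
  "graph_iso V1 E1 V2 E2 = (\<exists>f. bij_betw f V1 V2 \<and> (\<forall>a\<in>V1. \<forall>b\<in>V1. E1 a b \<longleftrightarrow> E2 (f a) (f b)))"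

definition star :: "'a set \<Rightarrow> ('a \<Rightarrow> 'a \<Rightarrow> bool) \<Rightarrow> 'a \<Rightarrow> 'a set" where
  "star X EG v = {u \<in> X. u = v \<or> EG v u}"

text \<open>Double of X along st(v): S_0 = (X - st v) x {0}, S_1 = (X - st v) x {1},
  and the star is kept as st v x {2}; rho_i is the first projection.\<close>
definition double_verts :: "'a set \<Rightarrow> ('a \<Rightarrow> 'a \<Rightarrow> bool) \<Rightarrow> 'a \<Rightarrow> ('a \<times> nat) set" where
  "double_verts X EG v = ((X - star X EG v) \<times> {0, 1}) \<union> (star X EG v \<times> {2})"

definition double_adj :: "'a set \<Rightarrow> ('a \<Rightarrow> 'a \<Rightarrow> bool) \<Rightarrow> 'a \<Rightarrow> ('a \<times> nat) \<Rightarrow> ('a \<times> nat) \<Rightarrow> bool" where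
  "double_adj X EG v p q =
     (fst p \<in> X \<and> fst q \<in> X \<and> EG (fst p) (fst q) \<and> (snd p = snd q \<or> snd p = 2 \<or> snd q = 2))"

end

theory Submission
  imports Defs "HOL-Library.Countable_Set"
begin

text \<open>
  Conjugation by a vertex \<open>x\<close> of the extension graph fixes the star of \<open>x\<close>, and the complement of
  the star splits into levels indexed by the integers, with no edges between different levels, which
  conjugation by \<open>x\<close> shifts by one. Hence the union of a finite set \<open>Y\<close> of vertices and its conjugate
  by a suitable power of \<open>x\<close> is the double of \<open>Y\<close> along the star of \<open>x\<close>. Start with the defining
  graph and double so that every vertex that occurs is used infinitely often. A finite union of
  conjugates of the defining graph, indexed by a finite connected part of the Cayley graph, is then
  embedded by induction on the number of conjugates: pick an edge from \<open>g\<close> to \<open>vg\<close>, shift all levels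
  of \<open>x = v\<^sup>g\<close> to level zero, which identifies \<open>vg\<close> with \<open>g\<close>, and recover the union from the
  smaller one by repeatedly doubling along \<open>x\<close>.

  The level of a group element is the signed number of those letters \<open>v\<close> in a word for it whose suffix
  centralizes \<open>v\<close>; it is invariant under the relations for trivial reasons. That it
  descends to vertices needs the centralizer theorem, proved with a pile model of the group.
\<close>

section \<open>Doubling along shears\<close>

text \<open>In the extension graph, \<open>\<tau> k\<close> is conjugation by \<open>x\<^sup>k\<close>.\<close>

definition shear ::
    "'b set \<Rightarrow> ('b \<Rightarrow> 'b \<Rightarrow> bool) \<Rightarrow> 'b \<Rightarrow> (int \<Rightarrow> 'b \<Rightarrow> 'b) \<Rightarrow> ('b \<Rightarrow> int) \<Rightarrow> bool" where
  "shear X adj x \<tau> l \<longleftrightarrow>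
     (\<forall>k. \<forall>y\<in>X. \<tau> k y \<in> X) \<and> (\<forall>y\<in>X. \<tau> 0 y = y) \<and>
     (\<forall>k m. \<forall>y\<in>X. \<tau> k (\<tau> m y) = \<tau> (k + m) y) \<and>
     (\<forall>k. \<forall>y\<in>X. \<forall>z\<in>X. adj (\<tau> k y) (\<tau> k z) = adj y z) \<and>
     (\<forall>k. \<forall>y\<in>star X adj x. \<tau> k y = y) \<and>
     (\<forall>k. \<forall>y\<in>X - star X adj x. l (\<tau> k y) = l y + k) \<and>
     (\<forall>y\<in>X - star X adj x. \<forall>z\<in>X - star X adj x. adj y z \<longrightarrow> l y = l z)"

text \<open>For \<open>Y\<close> inside \<open>X\<close>, the condition puts \<open>Y\<close> and
  its translate, off the star, on disjoint sets of levels, so that there they neither meet nor share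
  an edge.\<close>

definition double_step ::
    "'b set \<Rightarrow> ('b \<Rightarrow> 'b \<Rightarrow> bool) \<Rightarrow> 'b set \<Rightarrow> 'b \<Rightarrow> 'b set \<Rightarrow> bool" where
  "double_step X adj Y x Y' \<longleftrightarrow> (\<exists>\<tau> l m. shear X adj x \<tau> l \<and>
     (\<forall>y\<in>Y - star X adj x. \<forall>z\<in>Y - star X adj x. l y \<noteq> l z + m) \<and> Y' = Y \<union> \<tau> m ` Y)"

definition embeds ::
    "('b \<Rightarrow> 'b \<Rightarrow> bool) \<Rightarrow> 'b set \<Rightarrow> 'b set \<Rightarrow> ('b \<Rightarrow> 'b) \<Rightarrow> bool" where
  "embeds adj S T f \<longleftrightarrow> inj_on f S \<and> f ` S \<subseteq> T \<and> (\<forall>a\<in>S. \<forall>b\<in>S. adj a b \<longleftrightarrow> adj (f a) (f b))"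

lemma embeds_mono: "embeds adj S T f \<Longrightarrow> S' \<subseteq> S \<Longrightarrow> T \<subseteq> T' \<Longrightarrow> embeds adj S' T' f"
  unfolding embeds_def by (meson image_mono inj_on_subset order_trans subset_iff)

lemma embeds_iso:
  assumes "embeds adj S T f"
  shows "\<exists>T'\<subseteq>T. graph_iso S adj T' adj"
  using assms unfolding embeds_def graph_iso_def bij_betw_def by (intro exI[of _ "f ` S"]) blast

text \<open>What the doubling argument takes from the extension graph: countability, to schedule
  every vertex as a center, and a shear at each vertex.\<close>

locale sheared_graph =
  fixes X :: "'b set" and adj :: "'b \<Rightarrow> 'b \<Rightarrow> bool"
  assumes countable_X: "countable X"
    and shear_ex: "x \<in> X \<Longrightarrow> \<exists>\<tau> l. shear X adj x \<tau> l"
begin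

context
  fixes x \<tau> l
  assumes sh: "shear X adj x \<tau> l" and x: "x \<in> X"
begin

lemma shear_closed: "y \<in> X \<Longrightarrow> \<tau> k y \<in> X"
  and shear_zero: "y \<in> X \<Longrightarrow> \<tau> 0 y = y"
  and shear_add: "y \<in> X \<Longrightarrow> \<tau> k (\<tau> m y) = \<tau> (k + m) y"
  and shear_adj: "y \<in> X \<Longrightarrow> z \<in> X \<Longrightarrow> adj (\<tau> k y) (\<tau> k z) = adj y z"
  and shear_fix: "y \<in> star X adj x \<Longrightarrow> \<tau> k y = y"
  and shear_level: "y \<in> X \<Longrightarrow> y \<notin> star X adj x \<Longrightarrow> l (\<tau> k y) = l y + k"
  and shear_level_adj: "y \<in> X \<Longrightarrow> y \<notin> star X adj x \<Longrightarrow> z \<in> X \<Longrightarrow> z \<notin> star X adj x \<Longrightarrow>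
      adj y z \<Longrightarrow> l y = l z"
  using sh unfolding shear_def by blast+

lemma center_in_star: "x \<in> star X adj x"
  using x unfolding star_def by simp

lemma shear_inj: "y \<in> X \<Longrightarrow> z \<in> X \<Longrightarrow> \<tau> k y = \<tau> k z \<Longrightarrow> y = z"
  by (metis add.left_inverse shear_add shear_zero)

text \<open>If \<open>\<tau> k y\<close> lies in the star, it is fixed by
  \<open>\<tau> (-k)\<close>, which also sends it back to \<open>y\<close>.\<close>

lemma shear_star: "y \<in> X \<Longrightarrow> \<tau> k y \<in> star X adj x \<longleftrightarrow> y \<in> star X adj x"
  by (metis shear_add shear_fix shear_zero add.left_inverse)

end

section \<open>Doubles realized by shears\<close>

lemma double_step_ex:
  assumes "finite Y" "x \<in> Y" "Y \<subseteq> X"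
  shows "\<exists>Y'. double_step X adj Y x Y'"
proof -
  obtain \<tau> l where sh: "shear X adj x \<tau> l"
    using shear_ex assms by blast
  \<comment> \<open>A shift \<open>m\<close> outside the finite set of level differences in
    \<open>Y\<close> separates the two copies.\<close>
  have "finite ((\<lambda>(y, z). l y - l z) ` (Y \<times> Y))"
    using assms by simp
  then obtain m where "m \<notin> (\<lambda>(y, z). l y - l z) ` (Y \<times> Y)"
    using ex_new_if_finite infinite_UNIV_int by blast
  then have "\<forall>y\<in>Y. \<forall>z\<in>Y. l y \<noteq> l z + m"
    by force
  then show ?thesis
    using sh unfolding double_step_def by blast
qed

lemma double_step_props:
  assumes "double_step X adj Y x Y'" "x \<in> Y" "Y \<subseteq> X" "finite Y"
  shows "finite Y'" "Y \<subseteq> Y'" "Y' \<subseteq> X"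
  using assms shear_closed unfolding double_step_def by blast+

lemma double_step_iso:
  assumes "double_step X adj Y x Y'" "x \<in> Y" "Y \<subseteq> X"
  shows "graph_iso (double_verts Y adj x) (double_adj Y adj x) Y' adj"
proof -
  obtain \<tau> l m where sh: "shear X adj x \<tau> l"
    and sep: "\<And>y z. y \<in> Y \<Longrightarrow> z \<in> Y \<Longrightarrow> y \<notin> star X adj x \<Longrightarrow> z \<notin> star X adj x \<Longrightarrow> l y \<noteq> l z + m"
    and Y': "Y' = Y \<union> \<tau> m ` Y"
    using assms(1) unfolding double_step_def by blast
  have x: "x \<in> X" using assms by blast
  note [simp] = shear_closed[OF sh x] shear_adj[OF sh x] shear_star[OF sh x] shear_fix[OF sh x]
  have st: "star Y adj x = Y \<inter> star X adj x"
    using assms unfolding star_def by auto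
  have YX: "y \<in> Y \<Longrightarrow> y \<in> X" for y using assms by blast
  \<comment> \<open>Sheet 1 goes to the translated copy; sheet 0 and the star, tagged 2, stay in
    place.\<close>
  define f where "f = (\<lambda>(y, i::nat). if i = 1 then \<tau> m y else y)"
  \<comment> \<open>Off the star the level tells the two copies apart, and edges join only equal
    levels.\<close>
  have far: "y \<noteq> \<tau> m z" "\<not> adj y (\<tau> m z)" "\<not> adj (\<tau> m z) y"
    if "y \<in> Y" "z \<in> Y" "y \<notin> star X adj x" "z \<notin> star X adj x" for y z
  proof -
    have ne: "l y \<noteq> l (\<tau> m z)"
      using sep that shear_level[OF sh x] YX by simp
    then show "y \<noteq> \<tau> m z" by blast
    show "\<not> adj y (\<tau> m z)" "\<not> adj (\<tau> m z) y"
      using ne shear_level_adj[OF sh x, of y "\<tau> m z"] shear_level_adj[OF sh x, of "\<tau> m z" y] that YX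
      by auto
  qed
  \<comment> \<open>As \<open>y\<close> is fixed, \<open>adj y (\<tau> m z)\<close> is
    \<open>adj (\<tau> m y) (\<tau> m z)\<close>.\<close>
  have fixadj: "adj y (\<tau> m z) = adj y z" "adj (\<tau> m z) y = adj z y"
    if "y \<in> star X adj x" "z \<in> X" for y z
  proof -
    have "y \<in> X" using that unfolding star_def by blast
    then show "adj y (\<tau> m z) = adj y z" "adj (\<tau> m z) y = adj z y"
      using shear_adj[OF sh x, of y z m] shear_adj[OF sh x, of z y m] that by auto
  qed
  have inj: "inj_on f (double_verts Y adj x)"
  proof (rule inj_onI)
    fix p q assume p: "p \<in> double_verts Y adj x" and q: "q \<in> double_verts Y adj x" and eq: "f p = f q"
    obtain y i z j where pq: "p = (y, i)" "q = (z, j)"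
      by fastforce
    have yz: "y \<in> Y" "z \<in> Y" "i \<in> {0, 1} \<and> y \<notin> star X adj x \<or> i = 2 \<and> y \<in> star X adj x"
      "j \<in> {0, 1} \<and> z \<notin> star X adj x \<or> j = 2 \<and> z \<in> star X adj x"
      using p q unfolding pq double_verts_def st by auto
    have "\<tau> m y \<in> star X adj x \<longleftrightarrow> y \<in> star X adj x" "\<tau> m z \<in> star X adj x \<longleftrightarrow> z \<in> star X adj x"
      using yz YX by simp_all
    moreover have "\<tau> m y = \<tau> m z \<Longrightarrow> y = z"
      using shear_inj[OF sh x] yz YX by blast
    ultimately show "p = q"
      using yz eq far(1)[of y z] far(1)[of z y] unfolding pq f_def
      by (elim disjE conjE insertE emptyE) simp_all
  qed
  have img: "f ` double_verts Y adj x = Y'"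
  proof
    show "f ` double_verts Y adj x \<subseteq> Y'"
      unfolding Y' double_verts_def f_def st by auto
    have "y \<in> f ` double_verts Y adj x" if "y \<in> Y" for y
    proof (cases "y \<in> star X adj x")
      case True
      then show ?thesis using that
        by (intro image_eqI[of _ _ "(y, 2)"]) (auto simp: f_def double_verts_def st)
    next
      case False
      then show ?thesis using that
        by (intro image_eqI[of _ _ "(y, 0)"]) (auto simp: f_def double_verts_def st)
    qed
    moreover have "\<tau> m y \<in> f ` double_verts Y adj x" if "y \<in> Y" for y
    proof (cases "y \<in> star X adj x")
      case True
      then show ?thesis using that
        by (intro image_eqI[of _ _ "(y, 2)"]) (auto simp: f_def double_verts_def st)
    next
      case False
      then show ?thesis using that
        by (intro image_eqI[of _ _ "(y, 1)"]) (auto simp: f_def double_verts_def st)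
    qed
    ultimately show "Y' \<subseteq> f ` double_verts Y adj x"
      unfolding Y' by blast
  qed
  have "double_adj Y adj x p q \<longleftrightarrow> adj (f p) (f q)"
    if "p \<in> double_verts Y adj x" "q \<in> double_verts Y adj x" for p q
    using that far fixadj YX unfolding double_verts_def double_adj_def f_def st by auto
  then show ?thesis
    unfolding graph_iso_def bij_betw_def using inj img by blast
qed

text \<open>The recurrence clause is what allows embeddings to be extended: the image of a given
  vertex is a doubling center at some stage beyond any bound.\<close>

definition doubling_sequence :: "(nat \<Rightarrow> 'b set) \<Rightarrow> (nat \<Rightarrow> 'b) \<Rightarrow> bool" where
  "doubling_sequence G c \<longleftrightarrow>
    (\<forall>i. finite (G i) \<and> G i \<subseteq> X \<and> c i \<in> G i \<and> double_step X adj (G i) (c i) (G (Suc i))) \<and>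
    (\<forall>j n. \<forall>x\<in>G j. \<exists>i\<ge>n. c i = x)"

lemma doubling_sequence_ex:
  assumes "finite G0" "G0 \<noteq> {}" "G0 \<subseteq> X"
  obtains G c where "G 0 = G0" "doubling_sequence G c"
proof -
  \<comment> \<open>Decoding pairs makes the \<open>k\<close>-th vertex recur: it is listed at
    \<open>prod_encode (k, n)\<close>, which is at least \<open>n\<close>, for every
    \<open>n\<close>.\<close>
  define en where "en i = from_nat_into X (fst (prod_decode i))" for i
  have en: "\<exists>i\<ge>n. en i = x" if x: "x \<in> X" for x n
  proof -
    obtain k where "from_nat_into X k = x"
      using from_nat_into_surj[OF countable_X x] by blast
    then have "en (prod_encode (k, n)) = x"
      by (simp add: en_def)
    then show ?thesis using le_prod_encode_2 by blast
  qed
  \<comment> \<open>The scheduled vertex is the center if it is present; otherwise any vertex of the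
    stage fills in.\<close>
  define ch where "ch i Y = (if en i \<in> Y then en i else SOME y. y \<in> Y)" for i Y
  define G where "G = rec_nat G0 (\<lambda>i Y. SOME Y'. double_step X adj Y (ch i Y) Y')"
  define c where "c i = ch i (G i)" for i
  have ch: "ch i Y \<in> Y" if "Y \<noteq> {}" for i Y
    using that unfolding ch_def by (simp add: some_in_eq)
  have G0: "G 0 = G0" unfolding G_def by simp
  have inv: "finite (G i) \<and> G i \<noteq> {} \<and> G i \<subseteq> X \<and> double_step X adj (G i) (c i) (G (Suc i))" for i
  proof (induction i)
    case 0
    have "\<exists>Y'. double_step X adj G0 (ch 0 G0) Y'"
      using double_step_ex ch assms by blast
    then show ?case using assms unfolding c_def G_def by (simp add: someI_ex)
  next
    case (Suc i)
    have c: "c i \<in> G i" unfolding c_def using ch Suc by blast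
    have *: "finite (G (Suc i))" "G (Suc i) \<noteq> {}" "G (Suc i) \<subseteq> X"
      using double_step_props[of "G i" "c i" "G (Suc i)"] c Suc by blast+
    then have "\<exists>Y'. double_step X adj (G (Suc i)) (ch (Suc i) (G (Suc i))) Y'"
      using double_step_ex ch by blast
    then have "double_step X adj (G (Suc i)) (c (Suc i)) (G (Suc (Suc i)))"
      unfolding c_def G_def by (simp add: someI_ex)
    with * show ?case by blast
  qed
  have c: "c i \<in> G i" for i unfolding c_def using ch[of "G i" i] inv[of i] by simp
  have mono: "G i \<subseteq> G j" if "i \<le> j" for i j
  proof (rule lift_Suc_mono_le[OF _ that])
    show "G n \<subseteq> G (Suc n)" for n
      using double_step_props(2)[of "G n" "c n"] inv[of n] c[of n] by blast
  qed
  have "\<exists>i\<ge>n. c i = x" if x: "x \<in> G j" for x j n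
  proof -
    have "x \<in> X" using x inv by blast
    \<comment> \<open>An index past \<open>j\<close> as well, so that the stage already contains
      \<open>x\<close> when its turn comes.\<close>
    then obtain i where i: "i \<ge> max n j" "en i = x"
      using en by blast
    then have "en i \<in> G i" using mono[of j i] x by auto
    then have "c i = x" unfolding c_def ch_def using i by simp
    then show ?thesis using i by auto
  qed
  then show ?thesis
    using that[of G c] G0 inv c unfolding doubling_sequence_def by simp
qed

section \<open>Embedding unions of translates\<close>

context
  fixes G c
  assumes ds: "doubling_sequence G c"
begin

lemma
  shows sequence_finite: "finite (G i)"
    and sequence_subset: "G i \<subseteq> X"
    and center_mem: "c i \<in> G i"
    and sequence_step: "double_step X adj (G i) (c i) (G (Suc i))"
    and center_recurs: "x \<in> G j \<Longrightarrow> \<exists>i\<ge>n. c i = x"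
  using ds unfolding doubling_sequence_def by blast+

lemma sequence_mono:
  assumes "i \<le> j"
  shows "G i \<subseteq> G j"
proof (rule lift_Suc_mono_le[OF _ assms])
  show "G n \<subseteq> G (Suc n)" for n
    using double_step_props(2)[of "G n" "c n"] sequence_finite sequence_subset center_mem sequence_step by blast
qed

text \<open>Each further translate is realized in the second half of a double along the image of \<open>x\<close>;
  its level differs from the levels already present, so no edges are missing.\<close>

lemma embeds_union_translates:
  assumes sh: "shear X adj x \<tau> l" and T: "T \<subseteq> X" "x \<in> T"
    and level: "\<And>t. t \<in> T \<Longrightarrow> t \<notin> star X adj x \<Longrightarrow> l t = 0"
    and emb: "embeds adj T (G i0) f0"
    and K: "finite K" "K \<noteq> {}"
  shows "\<exists>j f. embeds adj (\<Union>k\<in>K. \<tau> k ` T) (G j) f"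
  using K
proof (induction K rule: finite_ne_induct)
  case (singleton k)
  have x: "x \<in> X" using T by blast
  have TX: "t \<in> T \<Longrightarrow> t \<in> X" for t using T by blast
  have inv: "\<tau> (-k) (\<tau> k t) = t" if "t \<in> T" for t
    using shear_add[OF sh x] shear_zero[OF sh x] TX that by simp
  have e: "inj_on f0 T" "f0 ` T \<subseteq> G i0" "\<And>a b. a \<in> T \<Longrightarrow> b \<in> T \<Longrightarrow> adj a b = adj (f0 a) (f0 b)"
    using emb unfolding embeds_def by blast+
  \<comment> \<open>Shift the single translate back by \<open>-k\<close>, then apply
    \<open>f0\<close>.\<close>
  have "embeds adj (\<tau> k ` T) (G i0) (f0 \<circ> \<tau> (-k))"
    unfolding embeds_def
  proof (intro conjI ballI)
    show "inj_on (f0 \<circ> \<tau> (-k)) (\<tau> k ` T)"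
      using e(1) inv by (auto simp: inj_on_def)
    show "(f0 \<circ> \<tau> (-k)) ` \<tau> k ` T \<subseteq> G i0"
      using e(2) inv by auto
    show "adj a b = adj ((f0 \<circ> \<tau> (-k)) a) ((f0 \<circ> \<tau> (-k)) b)" if "a \<in> \<tau> k ` T" "b \<in> \<tau> k ` T" for a b
      using that e(3) inv shear_adj[OF sh x] TX by auto
  qed
  then show ?case by auto
next
  case (insert k K)
  define TK where "TK = (\<Union>k\<in>K. \<tau> k ` T)"
  have x: "x \<in> X" using T by blast
  have TX: "t \<in> T \<Longrightarrow> t \<in> X" for t using T by blast
  note tau = shear_closed[OF sh x] shear_zero[OF sh x] shear_add[OF sh x] shear_adj[OF sh x]
    shear_fix[OF sh x] shear_star[OF sh x] shear_level[OF sh x] shear_level_adj[OF sh x] shear_inj[OF sh x]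
  \<comment> \<open>Any index already treated; new vertices are modelled on their copies at level
    \<open>k0\<close>.\<close>
  obtain k0 where k0: "k0 \<in> K" using insert by blast
  obtain j f where f: "embeds adj TK (G j) f" using insert unfolding TK_def by blast
  have xTK: "x \<in> TK"
    unfolding TK_def using k0 T tau(5)[of x k0] center_in_star[OF sh x] by force
  have "f x \<in> G j" using f xTK unfolding embeds_def by blast
  \<comment> \<open>The image of \<open>x\<close> is a center again at a later stage, where
    \<open>TK\<close> is still embedded.\<close>
  then obtain i where i: "i \<ge> j" "c i = f x" using center_recurs by blast
  define z where "z = f x"
  have fi: "embeds adj TK (G i) f" using embeds_mono[OF f order_refl sequence_mono[OF i(1)]] .
  have e: "\<And>a b. a \<in> TK \<Longrightarrow> b \<in> TK \<Longrightarrow> f a = f b \<Longrightarrow> a = b" "\<And>a. a \<in> TK \<Longrightarrow> f a \<in> G i"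
    "\<And>a b. a \<in> TK \<Longrightarrow> b \<in> TK \<Longrightarrow> adj (f a) (f b) = adj a b"
    using fi unfolding embeds_def inj_on_def by blast+
  have GX: "a \<in> G i \<Longrightarrow> a \<in> X" for a using sequence_subset by blast
  have fX: "a \<in> TK \<Longrightarrow> f a \<in> X" for a using e(2) GX by blast
  have z: "z \<in> X" unfolding z_def using xTK fX by blast
  obtain \<sigma> \<mu> m where shz: "shear X adj z \<sigma> \<mu>"
    and sep: "\<And>y w. y \<in> G i \<Longrightarrow> w \<in> G i \<Longrightarrow> y \<notin> star X adj z \<Longrightarrow> w \<notin> star X adj z \<Longrightarrow> \<mu> y \<noteq> \<mu> w + m"
    and GS: "G (Suc i) = G i \<union> \<sigma> m ` G i"
    using sequence_step[of i] i unfolding double_step_def z_def by (metis DiffI)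
  note sig = shear_closed[OF shz z] shear_zero[OF shz z] shear_add[OF shz z] shear_adj[OF shz z]
    shear_fix[OF shz z] shear_star[OF shz z] shear_level[OF shz z] shear_level_adj[OF shz z] shear_inj[OF shz z]
  have TKX: "a \<in> TK \<Longrightarrow> a \<in> X" for a unfolding TK_def using TX tau(1) by blast
  \<comment> \<open>The embedding matches equality with and adjacency to \<open>x\<close> with the
    same relations to its image \<open>z\<close>.\<close>
  have fstar: "f a \<in> star X adj z \<longleftrightarrow> a \<in> star X adj x" if "a \<in> TK" for a
    using that e(1)[OF that xTK] e(3)[OF xTK that] fX TKX unfolding star_def z_def by auto
  \<comment> \<open>The levels of \<open>TK\<close> off the star lie in \<open>K\<close>, hence
    differ from the new level \<open>k\<close>.\<close>
  have lTK: "l a \<in> K" if a: "a \<in> TK" and ns: "a \<notin> star X adj x" for a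
  proof -
    obtain k t where kt: "k \<in> K" "t \<in> T" "a = \<tau> k t"
      using a unfolding TK_def by blast
    then have "t \<notin> star X adj x" using ns TX tau(6)[of t k] by simp
    then have "l a = k" using kt TX tau(7)[of t k] level[of t] by simp
    then show ?thesis using kt by simp
  qed
  \<comment> \<open>\<open>h\<close> slides level \<open>k\<close> onto level \<open>k0\<close>,
    which is already embedded.\<close>
  define h where "h y = \<tau> (k0 - k) y" for y
  define N where "N = \<tau> k ` T - TK"
  have N: "b \<in> X \<and> b \<notin> star X adj x \<and> l b = k \<and> h b \<in> TK \<and> h b \<notin> star X adj x" if b: "b \<in> N" for b
  proof -
    obtain t where t: "t \<in> T" "b = \<tau> k t" using b unfolding N_def by blast
    have nt: "t \<notin> star X adj x"
    proof
      assume "t \<in> star X adj x"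
      then have "b = \<tau> k0 t" using t tau(5) by simp
      then have "b \<in> TK" using t k0 unfolding TK_def by blast
      then show False using b unfolding N_def by blast
    qed
    have "h b = \<tau> k0 t" unfolding h_def using t tau(3) TX by simp
    then show ?thesis
      using nt t TX tau(1) tau(6)[of t] tau(7)[of t k] level[of t] k0 unfolding TK_def by auto
  qed
  \<comment> \<open>A new vertex goes to the far half of the double: embed its copy at level
    \<open>k0\<close>, then shear by \<open>m\<close>.\<close>
  define g where "g y = (if y \<in> TK then f y else \<sigma> m (f (h y)))" for y
  have g1: "g a = f a" if "a \<in> TK" for a using that unfolding g_def by simp
  have g2: "g a = \<sigma> m (f (h a))" if "a \<in> N" for a using that unfolding g_def N_def by simp
  have mixed: "a \<noteq> b \<and> g a \<noteq> g b \<and> adj a b = adj (g a) (g b) \<and> adj b a = adj (g b) (g a)"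
    if a: "a \<in> TK" and b: "b \<in> N" for a b
  proof (cases "a \<in> star X adj x")
    case True
    \<comment> \<open>On the star both shears are trivial, so \<open>a\<close> and \<open>b\<close>
      can be compared after applying \<open>h\<close> in the source and before applying
      \<open>\<sigma> m\<close> in the target.\<close>
    have ha: "h a = a" unfolding h_def using True tau(5) by blast
    have fa: "f a = \<sigma> m (f a)" using True fstar a sig(5) by metis
    have "f (h b) \<noteq> f a" using True N[OF b] fstar[OF a] fstar[of "h b"] by metis
    then have "g a \<noteq> g b"
      using g1[OF a] g2[OF b] fa sig(9) fX a N[OF b] by metis
    moreover have "adj a b = adj (h a) (h b)" "adj b a = adj (h b) (h a)"
      unfolding h_def using tau(4) TKX[OF a] N[OF b] by simp_all
    moreover have "adj (g a) (g b) = adj (f a) (f (h b))" "adj (g b) (g a) = adj (f (h b)) (f a)"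
      using g1[OF a] g2[OF b] fa sig(4) fX a N[OF b] by metis+
    ultimately show ?thesis using ha e(3) a b N[OF b] unfolding N_def by auto
  next
    case False
    \<comment> \<open>Off the star both pairs lie on different levels, in the source since
      \<open>k\<close> is not in \<open>K\<close>, in the target by the choice of \<open>m\<close>.
      So neither pair is joined.\<close>
    have 1: "l a \<noteq> l b" using lTK[OF a False] N[OF b] insert by metis
    have na: "f a \<notin> star X adj z" "f (h b) \<notin> star X adj z" using False fstar a N[OF b] by auto
    have 2: "\<mu> (g a) \<noteq> \<mu> (g b)"
      using na sep[of "f a" "f (h b)"] sig(7)[of "f (h b)" m] g1[OF a] g2[OF b] e(2) a N[OF b] fX by simp
    have in_star: "g a \<notin> star X adj z" "g b \<notin> star X adj z" "g a \<in> X" "g b \<in> X"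
      using na g1[OF a] g2[OF b] sig(6)[of "f (h b)" m] sig(1) fX a N[OF b] by auto
    have "\<not> adj a b" "\<not> adj b a" using 1 tau(8) False TKX[OF a] N[OF b] by metis+
    moreover have "\<not> adj (g a) (g b)" "\<not> adj (g b) (g a)" using 2 sig(8) in_star by metis+
    ultimately show ?thesis using 1 2 by auto
  qed
  have new: "(g a = g b \<longrightarrow> a = b) \<and> adj a b = adj (g a) (g b)" if a: "a \<in> N" and b: "b \<in> N" for a b
  proof -
    have "g a = g b \<longrightarrow> h a = h b"
      using g2[OF a] g2[OF b] sig(9) fX N[OF a] N[OF b] e(1) by metis
    moreover have "h a = h b \<longrightarrow> a = b"
      unfolding h_def using tau(9) N[OF a] N[OF b] by blast
    moreover have "adj a b = adj (h a) (h b)" unfolding h_def using tau(4) N[OF a] N[OF b] by simp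
    moreover have "adj (g a) (g b) = adj (h a) (h b)"
      using g2[OF a] g2[OF b] sig(4) fX N[OF a] N[OF b] e(3) by metis
    ultimately show ?thesis by blast
  qed
  have old: "(g a = g b \<longrightarrow> a = b) \<and> adj a b = adj (g a) (g b)" if "a \<in> TK" "b \<in> TK" for a b
    using that e g1 by metis
  have U: "(\<Union>k\<in>insert k K. \<tau> k ` T) = TK \<union> N" unfolding TK_def N_def by blast
  have "embeds adj (TK \<union> N) (G (Suc i)) g"
    unfolding embeds_def
  proof (intro conjI ballI)
    show "inj_on g (TK \<union> N)"
    proof (rule inj_onI)
      fix a b assume "a \<in> TK \<union> N" "b \<in> TK \<union> N" "g a = g b"
      then show "a = b" using old new mixed by (metis Un_iff)
    qed
    show "g ` (TK \<union> N) \<subseteq> G (Suc i)"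
      unfolding GS using g1 g2 e(2) N by auto
    show "adj a b = adj (g a) (g b)" if "a \<in> TK \<union> N" "b \<in> TK \<union> N" for a b
      using that old new mixed by (metis Un_iff)
  qed
  then show ?case unfolding U by blast
qed

end

end

section \<open>Words and centralizers in right-angled Artin groups\<close>

lemma linv_simps [simp]: "linv (linv s) = s" "fst (linv s) = fst s" "snd (linv s) = (\<not> snd s)"
  unfolding linv_def by simp_all

lemma linv_pair [simp]: "linv (v, b) = (v, \<not> b)"
  unfolding linv_def by simp

lemma linv_eqI: "fst t = fst s \<Longrightarrow> snd t = (\<not> snd s) \<Longrightarrow> t = linv s"
  by (simp add: prod_eq_iff)

lemma winv_simps [simp]:
  "winv [] = []" "winv (s # w) = winv w @ [linv s]" "winv (w @ w') = winv w' @ winv w"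
  "winv (winv w) = w" "length (winv w) = length w"
  unfolding winv_def by (simp_all add: rev_map comp_def)

definition conj_word :: "'v letter list \<Rightarrow> 'v letter list \<Rightarrow> 'v letter list" where
  "conj_word q a = winv q @ a @ q"

lemma conj_word_append: "conj_word (q @ r) a = conj_word r (conj_word q a)"
  unfolding conj_word_def by simp

lemma conj_word_Nil [simp]: "conj_word [] a = a"
  unfolding conj_word_def by simp

locale raag =
  fixes V :: "'v set" and E :: "'v \<Rightarrow> 'v \<Rightarrow> bool"
  assumes E_sym: "a \<in> V \<Longrightarrow> b \<in> V \<Longrightarrow> E a b \<Longrightarrow> E b a"
    and E_irrefl: "a \<in> V \<Longrightarrow> \<not> E a a"
begin

section \<open>Congruence, inverses and conjugation of words\<close>

abbreviation eqv (infix "\<approx>" 50) where "a \<approx> b \<equiv> (a, b) \<in> raag_eq V E"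

abbreviation "W \<equiv> lists (V \<times> (UNIV :: bool set))"

abbreviation "star_words u \<equiv> lists (star V E u \<times> (UNIV :: bool set))"

definition commutes where "commutes a b \<longleftrightarrow> a @ b \<approx> b @ a"

text \<open>\<open>E\<close> is arbitrary outside \<open>V\<close>; cut down to \<open>V\<close> it
  is symmetric and irreflexive on the whole type.\<close>

definition lk :: "'v \<Rightarrow> 'v \<Rightarrow> bool" where "lk a b \<longleftrightarrow> a \<in> V \<and> b \<in> V \<and> E a b"

lemma lk_sym: "lk a b \<Longrightarrow> lk b a"
  unfolding lk_def using E_sym by blast

lemma lk_irrefl [simp]: "\<not> lk a a"
  unfolding lk_def using E_irrefl by blast

lemma star_iff: "v \<in> star V E u \<longleftrightarrow> v \<in> V \<and> (v = u \<or> E u v)"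
  unfolding star_def by simp

lemma star_words_W: "c \<in> star_words u \<Longrightarrow> c \<in> W"
  using lists_mono[of "star V E u \<times> UNIV" "V \<times> UNIV"] star_iff by fastforce

lemma linv_W [simp]: "linv s \<in> V \<times> UNIV \<longleftrightarrow> s \<in> V \<times> UNIV"
  unfolding linv_def by (simp add: mem_Times_iff)

lemma winv_W [simp]: "winv w \<in> W \<longleftrightarrow> w \<in> W"
  by (induction w) auto

lemma eqv_refl [simp, intro]: "a \<approx> a"
  unfolding raag_eq_def by simp

lemma eqv_sym: "a \<approx> b \<Longrightarrow> b \<approx> a"
  unfolding raag_eq_def
  by (metis converse_Un converse_converse rtrancl_converseI sup_commute)

lemma eqv_trans [trans]: "a \<approx> b \<Longrightarrow> b \<approx> c \<Longrightarrow> a \<approx> c"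
  unfolding raag_eq_def by (rule rtrancl_trans)

lemma eqv_step: "(a, b) \<in> raag_step V E \<Longrightarrow> a \<approx> b"
  unfolding raag_eq_def by blast

text \<open>Lets an invariant of group elements, such as a pile or a level, be defined on words and
  checked on single relation steps.\<close>

lemma eqv_invariant:
  assumes "\<And>a b. (a, b) \<in> raag_step V E \<Longrightarrow> F a = F b" and "a \<approx> b"
  shows "F a = F b"
  using assms(2) unfolding raag_eq_def
  by (induction rule: rtrancl_induct) (auto simp: assms(1))

lemma eqv_map:
  assumes "\<And>a b. (a, b) \<in> raag_step V E \<Longrightarrow> F a \<approx> F b" and "a \<approx> b"
  shows "F a \<approx> F b"
  using assms(2) unfolding raag_eq_def
proof (induction rule: rtrancl_induct)
  case (step y z)
  then have "F y \<approx> F z"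
    using assms(1) eqv_sym by blast
  then show ?case
    using step.IH eqv_trans unfolding raag_eq_def by blast
qed simp

lemma eqv_context: "a \<approx> b \<Longrightarrow> u @ a @ w \<approx> u @ b @ w"
proof (rule eqv_map[where F = "\<lambda>x. u @ x @ w"])
  fix a b assume "(a, b) \<in> raag_step V E"
  then show "u @ a @ w \<approx> u @ b @ w"
  proof cases
    case (cancel x u' w')
    then show ?thesis
      using eqv_step[OF raag_step.cancel[of x V "u @ u'" "w' @ w" E]] by simp
  next
    case (comm x y u' w')
    then show ?thesis
      using eqv_step[OF raag_step.comm[of x V y E "u @ u'" "w' @ w"]] by simp
  qed
qed

lemma eqv_append: "a \<approx> a' \<Longrightarrow> b \<approx> b' \<Longrightarrow> a @ b \<approx> a' @ b'"
  using eqv_trans[of "a @ b" "a' @ b" "a' @ b'"]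
    eqv_context[of a a' "[]" b] eqv_context[of b b' a' "[]"] by simp

lemma eqv_Cons: "a \<approx> b \<Longrightarrow> s # a \<approx> s # b"
  using eqv_append[of "[s]" "[s]" a b] by simp

lemma cancel_letter: "fst s \<in> V \<Longrightarrow> [s, linv s] \<approx> []" "fst s \<in> V \<Longrightarrow> [linv s, s] \<approx> []"
  using eqv_step[OF raag_step.cancel[of s V "[]" "[]" E]]
    eqv_step[OF raag_step.cancel[of "linv s" V "[]" "[]" E]] by simp_all

lemma winv_cong: "a \<approx> b \<Longrightarrow> winv a \<approx> winv b"
proof (rule eqv_map[where F = winv])
  fix a b assume "(a, b) \<in> raag_step V E"
  then show "winv a \<approx> winv b"
  proof cases
    case (cancel x u' w')
    then show ?thesis
      using eqv_step[OF raag_step.cancel[of x V "winv w'" "winv u'" E]] by simp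
  next
    case (comm x y u' w')
    then show ?thesis
      using eqv_step[OF raag_step.comm[of "linv y" V "linv x" E "winv w'" "winv u'"]] E_sym by simp
  qed
qed

lemma eqv_W: "a \<approx> b \<Longrightarrow> a \<in> W \<longleftrightarrow> b \<in> W"
proof (rule eqv_invariant)
  fix a b assume "(a, b) \<in> raag_step V E"
  then show "a \<in> W \<longleftrightarrow> b \<in> W"
    by cases (auto simp: mem_Times_iff)
qed

lemma winv_left: "w \<in> W \<Longrightarrow> winv w @ w \<approx> []"
proof (induction w)
  case (Cons s w)
  have "winv w @ [linv s, s] @ w \<approx> winv w @ [] @ w"
    using Cons by (intro eqv_context cancel_letter) auto
  also have "winv w @ [] @ w \<approx> []" using Cons by simp
  finally show ?case by simp
qed simp

lemma winv_right: "w \<in> W \<Longrightarrow> w @ winv w \<approx> []"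
  using winv_left[of "winv w"] by simp

lemma cancel_mid: "w \<in> W \<Longrightarrow> a @ winv w @ w @ b \<approx> a @ b" "w \<in> W \<Longrightarrow> a @ w @ winv w @ b \<approx> a @ b"
  using eqv_context[OF winv_left, of w a b] eqv_context[OF winv_right, of w a b] by simp_all

lemma conj_word_cong: "q \<approx> r \<Longrightarrow> a \<approx> b \<Longrightarrow> conj_word q a \<approx> conj_word r b"
  unfolding conj_word_def by (intro eqv_append winv_cong)

lemma conj_word_winv: "q \<in> W \<Longrightarrow> conj_word (winv q) (conj_word q a) \<approx> a"
  using conj_word_cong[OF winv_right[of q] eqv_refl[of a]] unfolding conj_word_append by simp

lemma commutes_sym: "commutes a b \<Longrightarrow> commutes b a"
  unfolding commutes_def by (rule eqv_sym)

lemma commutes_cong: "a \<approx> a' \<Longrightarrow> b \<approx> b' \<Longrightarrow> commutes a b \<longleftrightarrow> commutes a' b'"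
  unfolding commutes_def by (meson eqv_append eqv_sym eqv_trans)

lemma eqv_cong_iff: "a \<approx> a' \<Longrightarrow> b \<approx> b' \<Longrightarrow> a \<approx> b \<longleftrightarrow> a' \<approx> b'"
  by (meson eqv_sym eqv_trans)

lemma eqv_commutes: "a \<approx> b \<Longrightarrow> commutes a b"
  using commutes_cong[OF eqv_refl, of a b a] unfolding commutes_def by simp

lemma commutes_conj_imp:
  assumes "q \<in> W" "commutes a b"
  shows "commutes (conj_word q a) (conj_word q b)"
proof -
  have *: "conj_word q a @ conj_word q b \<approx> conj_word q (a @ b)" for a b
    using cancel_mid(2)[OF assms(1), of "winv q @ a" "b @ q"] unfolding conj_word_def by simp
  have "conj_word q (a @ b) \<approx> conj_word q (b @ a)"
    using assms conj_word_cong unfolding commutes_def by blast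
  then show ?thesis
    unfolding commutes_def using * eqv_sym eqv_trans by meson
qed

lemma commutes_conj:
  assumes "q \<in> W"
  shows "commutes (conj_word q a) (conj_word q b) \<longleftrightarrow> commutes a b"
  using commutes_conj_imp[OF assms] commutes_conj_imp[of "winv q" "conj_word q a" "conj_word q b"]
    commutes_cong conj_word_winv[OF assms] assms by (metis winv_W)

lemma commutes_iff_conj:
  assumes "a \<in> W"
  shows "commutes a b \<longleftrightarrow> conj_word a b \<approx> b"
proof
  assume "commutes a b"
  then have "winv a @ (b @ a) @ [] \<approx> winv a @ (a @ b) @ []"
    unfolding commutes_def by (rule eqv_context[OF eqv_sym])
  also have "winv a @ (a @ b) @ [] \<approx> b"
    using cancel_mid(1)[OF assms, of "[]" b] by simp
  finally show "conj_word a b \<approx> b"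
    unfolding conj_word_def by simp
next
  assume "conj_word a b \<approx> b"
  then have 1: "a @ conj_word a b \<approx> a @ b"
    by (rule eqv_append[OF eqv_refl])
  have 2: "a @ conj_word a b \<approx> b @ a"
    unfolding conj_word_def using cancel_mid(2)[OF assms, of "[]" "b @ a"] by simp
  show "commutes a b"
    unfolding commutes_def by (rule eqv_trans[OF eqv_sym[OF 1] 2])
qed

lemma commutes_star_letter:
  assumes "u \<in> V" "fst s \<in> star V E u"
  shows "commutes [s] [(u, b)]"
proof (cases "fst s = u")
  case True
  show ?thesis
  proof (cases "snd s = b")
    case True
    then have "s = (u, b)" using \<open>fst s = u\<close> by (simp add: prod_eq_iff)
    then show ?thesis unfolding commutes_def by simp
  next
    case False
    then have s: "(u, b) = linv s" using \<open>fst s = u\<close> by (simp add: prod_eq_iff)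
    have "fst s \<in> V" using True assms by simp
    then show ?thesis
      unfolding commutes_def s using eqv_trans[OF cancel_letter(1) eqv_sym[OF cancel_letter(2)]] by simp
  qed
next
  case False
  then have "fst s \<in> V" "E (fst s) u"
    using assms E_sym unfolding star_iff by blast+
  then show ?thesis
    using eqv_step[OF raag_step.comm[of s V "(u, b)" E "[]" "[]"]] assms(1)
    unfolding commutes_def by simp
qed

text \<open>The easy half of the centralizer theorem: the letters of \<open>c\<close> commute with
  \<open>u\<close> and are stripped off one at a time.\<close>

lemma conj_star_word:
  assumes "u \<in> V" "c \<in> star_words u"
  shows "conj_word c [(u, b)] \<approx> [(u, b)]"
  using assms(2)
proof (induction c)
  case (Cons s c)
  have "commutes [s] [(u, b)]"
    using Cons assms by (intro commutes_star_letter) auto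
  then have "conj_word [s] [(u, b)] \<approx> [(u, b)]"
    using commutes_iff_conj[of "[s]"] Cons star_iff by (simp add: mem_Times_iff)
  then have "conj_word ([s] @ c) [(u, b)] \<approx> [(u, b)]"
    unfolding conj_word_append using Cons conj_word_cong[of c c] eqv_trans by blast
  then show ?case by simp
qed simp

text \<open>A pile has one stack per vertex. A letter writes its sign on its own stack and the blank
  \<open>None\<close> on the stacks of all vertices that it does not commute with, unless it cancels the top of
  its own stack. This defines an action of the group, so piles tell group elements apart.\<close>

definition push :: "'v letter \<Rightarrow> ('v \<Rightarrow> bool option list) \<Rightarrow> 'v \<Rightarrow> bool option list" where
  "push s P = (\<lambda>i. if lk (fst s) i then P i
    else (if i = fst s then Some (snd s) else None) # P i)"

definition pop :: "'v letter \<Rightarrow> ('v \<Rightarrow> bool option list) \<Rightarrow> 'v \<Rightarrow> bool option list" where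
  "pop s P = (\<lambda>i. if lk (fst s) i then P i else tl (P i))"

definition cancels :: "'v letter \<Rightarrow> ('v \<Rightarrow> bool option list) \<Rightarrow> bool" where
  "cancels s P \<longleftrightarrow> (\<exists>r. P (fst s) = Some (\<not> snd s) # r)"

definition act :: "'v letter \<Rightarrow> ('v \<Rightarrow> bool option list) \<Rightarrow> 'v \<Rightarrow> bool option list" where
  "act s P = (if cancels s P then pop s P else push s P)"

text \<open>On arbitrary piles \<open>act\<close> need not be invertible, as \<open>pop\<close>
  discards whatever lies on top of the unlinked stacks. Valid piles are those written without
  cancellation.\<close>

inductive valid :: "('v \<Rightarrow> bool option list) \<Rightarrow> bool" where
  empty: "valid (\<lambda>_. [])"
| push: "valid P \<Longrightarrow> \<not> cancels s P \<Longrightarrow> valid (push s P)"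

lemma pop_push: "pop s (push (linv s) P) = P"
  unfolding pop_def push_def by auto

lemma cancels_push: "cancels s (push (linv s) P)"
  unfolding cancels_def push_def by simp

lemma push_commute: "lk (fst s) (fst t) \<Longrightarrow> push s (push t P) = push t (push s P)"
  unfolding push_def using lk_sym by (intro ext) auto

lemma cancels_push_lk: "lk (fst t) (fst s) \<Longrightarrow> cancels s (push t P) = cancels s P"
  unfolding cancels_def push_def by simp

lemma cancels_act_lk: "lk (fst t) (fst s) \<Longrightarrow> cancels s (act t P) = cancels s P"
  unfolding cancels_def act_def push_def pop_def by simp

text \<open>Look at the last letter pushed. It is \<open>linv s\<close> itself, or it is linked to
  \<open>s\<close>, since any other letter would cover the stack of \<open>s\<close> with a blank or
  the wrong sign. In the linked case it is moved past \<open>linv s\<close>.\<close>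

lemma valid_cancels:
  "valid P \<Longrightarrow> cancels s P \<Longrightarrow> \<exists>Q. valid Q \<and> \<not> cancels (linv s) Q \<and> P = push (linv s) Q"
proof (induction rule: valid.induct)
  case empty
  then show ?case unfolding cancels_def by simp
next
  case (push P t)
  show ?case
  proof (cases "fst t = fst s")
    case True
    then have "snd t = (\<not> snd s)"
      using push.prems unfolding cancels_def push_def by auto
    then have "t = linv s" using True by (intro linv_eqI)
    then show ?thesis using push by blast
  next
    case False
    then have l: "lk (fst t) (fst s)"
      using push.prems unfolding cancels_def push_def by (auto split: if_splits)
    then have "cancels s P" using push.prems cancels_push_lk by simp
    then obtain Q where Q: "valid Q" "\<not> cancels (linv s) Q" "P = local.push (linv s) Q"
      using push by blast
    have "\<not> cancels t Q"
      using push Q cancels_push_lk[of "linv s" t Q] lk_sym[OF l] by simp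
    then have "valid (local.push t Q)" using Q valid.push by blast
    moreover have "\<not> cancels (linv s) (local.push t Q)"
      using Q l cancels_push_lk[of t "linv s" Q] by simp
    moreover have "local.push t P = local.push (linv s) (local.push t Q)"
      unfolding Q using push_commute[of t "linv s" Q] l by simp
    ultimately show ?thesis by blast
  qed
qed

lemma act_valid: "valid P \<Longrightarrow> valid (act s P)"
  using valid_cancels[of P s] pop_push[of s] valid.push unfolding act_def by auto

lemma act_linv: "valid P \<Longrightarrow> act (linv s) (act s P) = P"
  using valid_cancels[of P s] pop_push[of s] pop_push[of "linv s"] cancels_push[of "linv s" P]
  unfolding act_def by auto

text \<open>If a letter cancels on \<open>P\<close>, then \<open>P\<close> is the image under its
  inverse of a pile \<open>Q\<close> on which that inverse is merely pushed; the claim at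
  \<open>Q\<close> transfers to \<open>P\<close> by \<open>act_linv\<close>. Two such reductions
  lead to the case of two pushes, which commute.\<close>

lemma act_commute:
  assumes P: "valid P" and l: "lk (fst s) (fst t)"
  shows "act s (act t P) = act t (act s P)"
proof -
  have l': "lk (fst t) (fst s)" using lk_sym l .
  have push_case: "act s (act t P) = act t (act s P)"
    if "\<not> cancels s P" "\<not> cancels t P" "lk (fst s) (fst t)" for s t P
    using that lk_sym[OF that(3)] push_commute[OF that(3)]
      cancels_push_lk[of s t P] cancels_push_lk[of t s P] by (simp add: act_def)
  have half: "act s (act t P) = act t (act s P)"
    if P: "valid P" and n: "\<not> cancels t P" and l: "lk (fst s) (fst t)" for s t P
  proof (cases "cancels s P")
    case True
    obtain Q where Q: "valid Q" "\<not> cancels (linv s) Q" "P = push (linv s) Q"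
      using valid_cancels[OF P True] by blast
    have PQ: "P = act (linv s) Q" using Q by (simp add: act_def)
    have "\<not> cancels t Q" using n l unfolding PQ by (simp add: cancels_act_lk)
    then have c: "act t (act (linv s) Q) = act (linv s) (act t Q)"
      using push_case[of "linv s" Q t] Q l by simp
    have "act s (act (linv s) (act t Q)) = act t Q" "act s (act (linv s) Q) = Q"
      using act_linv[of "act t Q" "linv s"] act_linv[of Q "linv s"] act_valid Q by simp_all
    then show ?thesis unfolding PQ c by simp
  next
    case False
    then show ?thesis using push_case n l by blast
  qed
  show ?thesis
  proof (cases "cancels t P")
    case True
    obtain Q where Q: "valid Q" "\<not> cancels (linv t) Q" "P = push (linv t) Q"
      using valid_cancels[OF P True] by blast
    have PQ: "P = act (linv t) Q" using Q by (simp add: act_def)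
    have c: "act s (act (linv t) Q) = act (linv t) (act s Q)"
      using half[of Q "linv t" s] Q l by simp
    have "act t (act (linv t) (act s Q)) = act s Q" "act t (act (linv t) Q) = Q"
      using act_linv[of "act s Q" "linv t"] act_linv[of Q "linv t"] act_valid Q by simp_all
    then show ?thesis unfolding PQ c by simp
  next
    case False
    then show ?thesis using half P l by blast
  qed
qed

text \<open>Letters act from left to right, so the top of a stack reflects the end of the
  word.\<close>

definition pile :: "'v letter list \<Rightarrow> 'v \<Rightarrow> bool option list" where
  "pile w = fold act w (\<lambda>_. [])"

lemma fold_act_valid: "valid P \<Longrightarrow> valid (fold act w P)"
  by (induction w arbitrary: P) (auto intro: act_valid)

lemma pile_cong: "a \<approx> b \<Longrightarrow> pile a = pile b"
proof (rule eqv_invariant)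
  fix a b assume "(a, b) \<in> raag_step V E"
  then show "pile a = pile b"
  proof cases
    case (cancel x u w)
    then show ?thesis unfolding pile_def
      using act_linv[OF fold_act_valid[OF valid.empty]] by simp
  next
    case (comm x y u w)
    then have "lk (fst x) (fst y)" unfolding lk_def by simp
    then show ?thesis unfolding pile_def comm
      using act_commute[OF fold_act_valid[OF valid.empty], of x y u] by simp
  qed
qed

section \<open>Reduced words\<close>

fun reduced_over :: "('v \<Rightarrow> bool option list) \<Rightarrow> 'v letter list \<Rightarrow> bool" where
  "reduced_over P [] \<longleftrightarrow> True"
| "reduced_over P (s # w) \<longleftrightarrow> \<not> cancels s P \<and> reduced_over (push s P) w"

definition raw_pile :: "'v letter list \<Rightarrow> 'v \<Rightarrow> bool option list" where
  "raw_pile w = fold push w (\<lambda>_. [])"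

abbreviation "reduced \<equiv> reduced_over (\<lambda>_. [])"

lemma reduced_over_append:
  "reduced_over P (a @ b) \<longleftrightarrow> reduced_over P a \<and> reduced_over (fold push a P) b"
  by (induction a arbitrary: P) auto

lemma fold_push: "fold push w P = (\<lambda>i. raw_pile w i @ P i)"
proof (induction w rule: rev_induct)
  case (snoc s w)
  then show ?case unfolding raw_pile_def by (auto simp: push_def fun_eq_iff)
qed (simp add: raw_pile_def)

lemma raw_pile_simps [simp]:
  "raw_pile [] = (\<lambda>_. [])" "raw_pile (w @ [s]) = push s (raw_pile w)"
  "raw_pile (a @ b) i = raw_pile b i @ raw_pile a i"
  by (simp add: raw_pile_def, simp add: raw_pile_def,
      simp add: raw_pile_def[of "a @ b"] raw_pile_def[of a, symmetric] fold_push[of b])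

lemma fold_act_reduced: "reduced_over P w \<Longrightarrow> fold act w P = fold push w P"
  by (induction w arbitrary: P) (auto simp: act_def)

lemma pile_reduced: "reduced w \<Longrightarrow> pile w = raw_pile w"
  unfolding pile_def raw_pile_def by (rule fold_act_reduced)

text \<open>Every letter not linked to \<open>v\<close> leaves a sign or a blank on the stack of
  \<open>v\<close>.\<close>

lemma raw_pile_empty: "raw_pile w v = [] \<longleftrightarrow> (\<forall>t\<in>set w. lk (fst t) v)"
  by (induction w rule: rev_induct) (auto simp: push_def)

text \<open>A sign on top means that the last letter not linked to \<open>v\<close> is
  \<open>(v, b)\<close>: the letters after it are linked to \<open>v\<close>, so it can be moved to
  the end.\<close>

lemma raw_pile_peel:
  assumes "w \<in> W" "raw_pile w v = Some b # r"
  shows "\<exists>w'\<in>W. w \<approx> w' @ [(v, b)] \<and> length w = Suc (length w')"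
  using assms
proof (induction w rule: rev_induct)
  case (snoc s w)
  show ?case
  proof (cases "fst s = v")
    case True
    then have "s = (v, b)" using snoc.prems by (auto simp: push_def prod_eq_iff simp del: raw_pile_simps(3))
    then show ?thesis using snoc.prems by auto
  next
    case False
    then have l: "lk (fst s) v" "raw_pile w v = Some b # r"
      using snoc.prems by (auto simp: push_def simp del: raw_pile_simps(3) split: if_splits)
    then obtain w' where w': "w' \<in> W" "w \<approx> w' @ [(v, b)]" "length w = Suc (length w')"
      using snoc by auto
    have "commutes [s] [(v, b)]"
      using l(1) lk_sym[OF l(1)] unfolding lk_def by (intro commutes_star_letter) (simp_all add: star_iff)
    then have "w' @ ([(v, b)] @ [s]) @ [] \<approx> w' @ ([s] @ [(v, b)]) @ []"
      unfolding commutes_def by (rule eqv_context[OF eqv_sym])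
    then have 1: "(w' @ [(v, b)]) @ [s] \<approx> (w' @ [s]) @ [(v, b)]" by simp
    have "w @ [s] \<approx> (w' @ [(v, b)]) @ [s]"
      using w' by (intro eqv_append) auto
    then have "w @ [s] \<approx> (w' @ [s]) @ [(v, b)]"
      using 1 by (rule eqv_trans)
    moreover have "w' @ [s] \<in> W" using w' snoc.prems by auto
    ultimately show ?thesis using w' by fastforce
  qed
qed simp

text \<open>The first letter that cancels finds the sign of its inverse on top of its stack;
  \<open>raw_pile_peel\<close> brings that inverse next to it.\<close>

lemma not_reduced_shorter:
  "w \<in> W \<Longrightarrow> \<not> reduced w \<Longrightarrow> \<exists>w'\<in>W. w \<approx> w' \<and> length w' < length w"
proof (induction w rule: rev_induct)
  case (snoc s w)
  have sw: "fst s \<in> V" "w \<in> W" using snoc.prems by auto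
  show ?case
  proof (cases "reduced w")
    case True
    then have "cancels s (raw_pile w)"
      using snoc.prems by (auto simp: reduced_over_append raw_pile_def)
    then obtain r where "raw_pile w (fst s) = Some (\<not> snd s) # r"
      unfolding cancels_def by blast
    then obtain w' where w': "w' \<in> W" "w \<approx> w' @ [(fst s, \<not> snd s)]" "length w = Suc (length w')"
      using raw_pile_peel sw by blast
    have "w @ [s] \<approx> (w' @ [linv s]) @ [s]"
      using w' unfolding linv_def by (intro eqv_append) auto
    also have "(w' @ [linv s]) @ [s] \<approx> w'"
      using eqv_context[OF cancel_letter(2)[OF sw(1)], of w' "[]"] by simp
    finally show ?thesis using w' by force
  next
    case False
    then obtain w' where "w' \<in> W" "w \<approx> w'" "length w' < length w"
      using snoc sw by blast
    then show ?thesis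
      using snoc.prems eqv_append[of w w' "[s]" "[s]"] by (intro bexI[of _ "w' @ [s]"]) auto
  qed
qed simp

text \<open>The first letter of \<open>y\<close> that cancels cannot remove a sign written by
  \<open>y\<close> itself, as \<open>y\<close> is reduced. So the preceding letters have not touched
  its stack, and the sign comes from \<open>P\<close>.\<close>

lemma reduced_over_first_cancel:
  assumes y: "reduced y" and n: "\<not> reduced_over P y"
  shows "\<exists>y1 s y2. y = y1 @ s # y2 \<and> (\<forall>t\<in>set y1. lk (fst t) (fst s)) \<and> cancels s P"
proof -
  have "\<exists>y1 s y2. y = y1 @ s # y2 \<and> cancels s (fold push y1 P)"
    using n
  proof (induction y arbitrary: P)
    case (Cons t y)
    show ?case
    proof (cases "cancels t P")
      case True
      then show ?thesis by (intro exI[of _ "[]"]) auto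
    next
      case False
      then obtain y1 s y2 where "y = y1 @ s # y2" "cancels s (fold push y1 (push t P))"
        using Cons.IH[of "push t P"] Cons.prems by auto
      then show ?thesis by (intro exI[of _ "t # y1"]) auto
    qed
  qed simp
  then obtain y1 s y2 where s: "y = y1 @ s # y2" "cancels s (fold push y1 P)"
    by blast
  have "\<not> cancels s (raw_pile y1)"
    using y unfolding s raw_pile_def by (simp add: reduced_over_append)
  then have "raw_pile y1 (fst s) = []"
    using s(2) unfolding fold_push cancels_def by (cases "raw_pile y1 (fst s)") auto
  then have "\<forall>t\<in>set y1. lk (fst t) (fst s)" "cancels s P"
    using s(2) unfolding raw_pile_empty[symmetric] fold_push cancels_def by auto
  then show ?thesis using s by blast
qed

lemma move_to_front:
  "(\<forall>t\<in>set y. lk (fst t) (fst s)) \<Longrightarrow> y @ [s] \<approx> s # y"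
proof (induction y)
  case (Cons t y)
  have "commutes [s] [t]"
    using commutes_star_letter[of "fst t" s "snd t"] Cons.prems lk_sym
    unfolding lk_def star_iff by simp
  then have "([t] @ [s]) @ y \<approx> ([s] @ [t]) @ y"
    unfolding commutes_def by (rule eqv_append[OF eqv_sym eqv_refl])
  then have 1: "t # s # y \<approx> s # t # y" by simp
  have "t # y @ [s] \<approx> t # s # y"
    using Cons by (intro eqv_Cons) simp
  then show ?case
    using eqv_trans[OF _ 1] by simp
qed simp

section \<open>The centralizer theorem\<close>

lemma letters_commute:
  assumes "commutes [(u, True)] [(w, True)]" "u \<in> V" "w \<in> V"
  shows "w \<in> star V E u"
proof (rule ccontr)
  assume "w \<notin> star V E u"
  then have n: "w \<noteq> u" "\<not> lk u w" "\<not> lk w u"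
    using assms lk_sym by (auto simp: star_iff lk_def)
  \<comment> \<open>On the stack of \<open>w\<close>, one order leaves the sign above a blank, the
    other a blank above the sign.\<close>
  have "pile [(u, True), (w, True)] w = pile [(w, True), (u, True)] w"
    using assms pile_cong unfolding commutes_def by fastforce
  then show False
    using n by (auto simp: pile_def act_def cancels_def push_def split: if_splits)
qed

lemma letters_eqv: "[(u, True)] \<approx> [(w, True)] \<Longrightarrow> u = w"
proof (rule ccontr)
  assume "[(u, True)] \<approx> [(w, True)]" "u \<noteq> w"
  then have "pile [(u, True)] u = pile [(w, True)] u"
    using pile_cong by metis
  then show False
    using \<open>u \<noteq> w\<close> by (auto simp: pile_def act_def cancels_def push_def split: if_splits)
qed

text \<open>For \<open>h\<close> of minimal length in its double coset, \<open>h\<inverse> w h u\<close> and \<open>u h\<inverse> w h\<close> are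
  both reduced; if \<open>h\<close> is nontrivial, their piles differ at the top of the stack of \<open>u\<close>.\<close>

lemma commutes_conj_double_coset:
  assumes u: "u \<in> V" and w: "w \<in> V" and h: "h \<in> W"
    and "commutes [(u, True)] (conj_word h [(w, True)])"
  shows "w \<in> star V E u \<and> (\<exists>c\<in>star_words w. \<exists>d\<in>star_words u. h \<approx> c @ d)"
  using h assms(4)
proof (induction "length h" arbitrary: h rule: less_induct)
  case less
  note h = less.prems(1) and com = less.prems(2)
  show ?case
  proof (cases "\<exists>c\<in>star_words w. \<exists>d\<in>star_words u. \<exists>h'\<in>W. h \<approx> c @ h' @ d \<and> length h' < length h")
    case True
    then obtain c d h' where cd: "c \<in> star_words w" "d \<in> star_words u" "h' \<in> W"
      "h \<approx> c @ h' @ d" "length h' < length h" by blast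
    \<comment> \<open>Star factors at the two ends do not affect commutation, so the shorter
      \<open>h'\<close> falls under the induction hypothesis.\<close>
    have "conj_word h [(w, True)] \<approx> conj_word d (conj_word h' (conj_word c [(w, True)]))"
      using conj_word_cong[OF cd(4) eqv_refl] by (simp add: conj_word_append)
    also have "conj_word d (conj_word h' (conj_word c [(w, True)])) \<approx> conj_word d (conj_word h' [(w, True)])"
      using conj_star_word[OF w cd(1)] by (intro conj_word_cong) auto
    finally have "commutes (conj_word d [(u, True)]) (conj_word d (conj_word h' [(w, True)]))"
      using com commutes_cong conj_star_word[OF u cd(2)] by blast
    then have "commutes [(u, True)] (conj_word h' [(w, True)])"
      using commutes_conj star_words_W[OF cd(2)] by blast
    then obtain c' d' where *: "w \<in> star V E u" "c' \<in> star_words w" "d' \<in> star_words u" "h' \<approx> c' @ d'"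
      using less.hyps[OF cd(5,3)] by blast
    have "c @ h' @ d \<approx> c @ (c' @ d') @ d"
      using * by (intro eqv_context)
    then have "h \<approx> (c @ c') @ (d' @ d)"
      using eqv_trans[OF cd(4)] by simp
    moreover have "c @ c' \<in> star_words w" "d' @ d \<in> star_words u" using * cd by auto
    ultimately show ?thesis using *(1) by blast
  next
    case False
    have min: "length h \<le> length h'"
      if "c \<in> star_words w" "d \<in> star_words u" "h' \<in> W" "h \<approx> c @ h' @ d" for c d h'
      using False that not_le by blast
    show ?thesis
    proof (cases h rule: rev_cases)
      case Nil
      then show ?thesis
        using letters_commute[of u w] com u w by (auto intro!: bexI[of _ "[]"])
    next
      case (snoc h0 s)
      \<comment> \<open>A final letter in the star of \<open>u\<close> could be split off, against
        minimality.\<close>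
      have right: "fst s \<notin> star V E u"
      proof
        assume "fst s \<in> star V E u"
        then show False
          using min[of "[]" "[s]" h0] h snoc by (simp add: mem_Times_iff)
      qed
      have red_h: "reduced h"
        using not_reduced_shorter[OF h] min[of "[]" "[]"] by fastforce
      have red_hi: "reduced (winv h)"
      proof (rule ccontr)
        assume "\<not> reduced (winv h)"
        then obtain k where "k \<in> W" "winv h \<approx> k" "length k < length h"
          using not_reduced_shorter[of "winv h"] h by auto
        then show False
          using min[of "[]" "[]" "winv k"] winv_cong[of "winv h" k] by simp
      qed
      \<comment> \<open>If \<open>w\<close> cancelled, \<open>h\<close> could be written with first
        letter \<open>w\<close>, which minimality forbids.\<close>
      have red1: "reduced (winv h @ [(w, True)])"
      proof (rule ccontr)
        assume "\<not> ?thesis"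
        then obtain r where "raw_pile (winv h) w = Some False # r"
          using red_hi by (auto simp: reduced_over_append cancels_def raw_pile_def)
        then obtain k where k: "k \<in> W" "winv h \<approx> k @ [(w, False)]" "length h = Suc (length k)"
          using raw_pile_peel[of "winv h" w False r] h by (auto simp del: in_lists_conv_set)
        then have "h \<approx> [(w, True)] @ winv k @ []"
          using winv_cong[OF k(2)] by simp
        then show False
          using min[of "[(w, True)]" "[]" "winv k"] k w by (auto simp: star_iff)
      qed
      \<comment> \<open>A cancelling letter \<open>t\<close> can be moved to the front of
        \<open>h\<close>, so minimality keeps it out of the star of \<open>w\<close>; then the
        letter \<open>w\<close> has put a blank on its stack, not a sign.\<close>
      have red2: "reduced ((winv h @ [(w, True)]) @ h)"
      proof (rule ccontr)
        assume "\<not> ?thesis"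
        then have "\<not> reduced_over (raw_pile (winv h @ [(w, True)])) h"
          using red1 by (simp add: reduced_over_append raw_pile_def)
        then obtain y1 t y2 where t: "h = y1 @ t # y2" "\<forall>x\<in>set y1. lk (fst x) (fst t)"
          "cancels t (raw_pile (winv h @ [(w, True)]))"
          using reduced_over_first_cancel[OF red_h] by blast
        have "y1 @ [t] \<approx> t # y1" using move_to_front t(2) by blast
        then have "h \<approx> [t] @ (y1 @ y2) @ []"
          unfolding t(1) using eqv_append[of "y1 @ [t]" "t # y1" y2 y2] by simp
        then have "fst t \<notin> star V E w"
          using min[of "[t]" "[]" "y1 @ y2"] h t(1) by (auto simp: mem_Times_iff)
        moreover have "fst t \<in> V" using h t(1) by auto
        ultimately have "fst t \<noteq> w" "\<not> lk w (fst t)"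
          unfolding star_iff lk_def by auto
        then show False
          using t(3) unfolding cancels_def raw_pile_simps(2) push_def by auto
      qed
      define z where "z = winv h @ [(w, True)] @ h"
      have red_z: "reduced z" using red2 unfolding z_def by simp
      have su: "fst s \<noteq> u" "\<not> lk (fst s) u"
        using right h snoc E_sym unfolding star_iff lk_def by auto
      \<comment> \<open>The last letter of \<open>h\<close> is outside the star of \<open>u\<close>,
        so it leaves a blank on the stack of \<open>u\<close>.\<close>
      have "raw_pile h u = None # raw_pile h0 u"
        unfolding snoc raw_pile_simps(2) using su by (simp add: push_def)
      then obtain r where zr: "raw_pile z u = None # r"
        using raw_pile_simps(3)[of "winv h @ [(w, True)]" h u] unfolding z_def by simp
      have "reduced (z @ [(u, True)])"
        using red_z zr by (simp add: reduced_over_append cancels_def raw_pile_def[symmetric])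
      then have pl: "pile (z @ [(u, True)]) u = Some True # None # r"
        using zr pile_reduced by (simp add: push_def del: raw_pile_simps(3))
      \<comment> \<open>A cancellation would need a letter of \<open>z\<close> over \<open>u\<close>
        preceded only by letters linked to \<open>u\<close>, but \<open>z\<close> starts with
        \<open>linv s\<close>, whose vertex is neither \<open>u\<close> nor linked to it.\<close>
      have "reduced ([(u, True)] @ z)"
      proof (rule ccontr)
        assume "\<not> ?thesis"
        then have "\<not> reduced_over (raw_pile [(u, True)]) z"
          by (simp add: reduced_over_append raw_pile_def cancels_def)
        then obtain y1 t y2 where t: "z = y1 @ t # y2" "\<forall>x\<in>set y1. lk (fst x) (fst t)"
          "cancels t (raw_pile [(u, True)])"
          using reduced_over_first_cancel[OF red_z] by blast
        have tu: "fst t = u"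
          using t(3) unfolding cancels_def raw_pile_def push_def by (auto split: if_splits)
        have "hd z = linv s" unfolding z_def snoc by simp
        then show False
          using t tu su by (cases y1) auto
      qed
      \<comment> \<open>Here a blank tops the stack of \<open>u\<close>, against a sign for the
        other product.\<close>
      then have "pile ([(u, True)] @ z) u = None # r @ raw_pile [(u, True)] u"
        using zr by (simp only: pile_reduced raw_pile_simps(3)) simp
      moreover have "pile (z @ [(u, True)]) = pile ([(u, True)] @ z)"
        using com pile_cong unfolding commutes_def conj_word_def z_def by metis
      ultimately show ?thesis using pl by simp
    qed
  qed
qed

lemma conj_word_eqv_iff:
  assumes "p \<in> W"
  shows "conj_word p a \<approx> conj_word p b \<longleftrightarrow> a \<approx> b"
proof
  assume "conj_word p a \<approx> conj_word p b"
  then have "conj_word (winv p) (conj_word p a) \<approx> conj_word (winv p) (conj_word p b)"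
    by (rule conj_word_cong[OF eqv_refl])
  then show "a \<approx> b"
    unfolding eqv_cong_iff[OF conj_word_winv[OF assms] conj_word_winv[OF assms]] .
qed (rule conj_word_cong[OF eqv_refl])

text \<open>The double coset result writes \<open>h @ winv g\<close> as \<open>c @ d\<close>.
  Conjugation by \<open>c\<close> fixes \<open>w\<close> and conjugation by \<open>d\<close> fixes
  \<open>u\<close>, so \<open>k = d @ g\<close> works for both vertices.\<close>

lemma common_conjugator:
  assumes u: "u \<in> V" and w: "w \<in> V" and g: "g \<in> W" and h: "h \<in> W"
    and com: "commutes (conj_word g [(u, True)]) (conj_word h [(w, True)])"
  shows "\<exists>k\<in>W. conj_word g [(u, True)] \<approx> conj_word k [(u, True)] \<and>
    conj_word h [(w, True)] \<approx> conj_word k [(w, True)] \<and>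
    (\<exists>c\<in>star_words w. h \<approx> c @ k) \<and> (\<exists>d\<in>star_words u. k = d @ g)"
proof -
  have "commutes (conj_word (winv g) (conj_word g [(u, True)])) (conj_word (winv g) (conj_word h [(w, True)]))"
    using com g commutes_conj by simp
  then have "commutes [(u, True)] (conj_word (h @ winv g) [(w, True)])"
    unfolding conj_word_append using commutes_cong[OF conj_word_winv[OF g] eqv_refl] by blast
  moreover have "h @ winv g \<in> W" using g h by simp
  ultimately obtain c d where cd: "c \<in> star_words w" "d \<in> star_words u"
    "h @ winv g \<approx> c @ d"
    using commutes_conj_double_coset[OF u w] by blast
  have 1: "h @ winv g @ g \<approx> (c @ d) @ g"
    using eqv_append[OF cd(3) eqv_refl[of g]] by simp
  have 2: "h @ winv g @ g \<approx> h"
    using cancel_mid(1)[OF g, of h "[]"] by simp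
  have hk: "h \<approx> c @ (d @ g)"
    using eqv_trans[OF eqv_sym[OF 2] 1] by simp
  have "conj_word h [(w, True)] \<approx> conj_word (d @ g) (conj_word c [(w, True)])"
    unfolding conj_word_append[symmetric] using hk by (intro conj_word_cong) auto
  also have "conj_word (d @ g) (conj_word c [(w, True)]) \<approx> conj_word (d @ g) [(w, True)]"
    using conj_star_word[OF w cd(1)] by (intro conj_word_cong) auto
  finally have 1: "conj_word h [(w, True)] \<approx> conj_word (d @ g) [(w, True)]" .
  have 2: "conj_word g [(u, True)] \<approx> conj_word (d @ g) [(u, True)]"
    unfolding conj_word_append by (rule conj_word_cong[OF eqv_refl eqv_sym[OF conj_star_word[OF u cd(2)]]])
  have "d @ g \<in> W" using g star_words_W[OF cd(2)] by simp
  then show ?thesis using 1 2 hk cd by blast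
qed

text \<open>Equal elements commute, so a common conjugator reduces the first claim to single
  generators; the two star factors then belong to the same star.\<close>

lemma conjugate_generators_eqD:
  assumes "u \<in> V" "w \<in> V" "g \<in> W" "h \<in> W"
    and eq: "conj_word g [(u, True)] \<approx> conj_word h [(w, True)]"
  shows "u = w" "\<exists>c\<in>star_words u. h \<approx> c @ g"
proof -
  obtain k c d where k: "k \<in> W" "conj_word g [(u, True)] \<approx> conj_word k [(u, True)]"
    "conj_word h [(w, True)] \<approx> conj_word k [(w, True)]"
    and cd: "c \<in> star_words w" "h \<approx> c @ k" "d \<in> star_words u" "k = d @ g"
    using common_conjugator[OF assms(1-4) eqv_commutes[OF eq]] by blast
  have "conj_word k [(u, True)] \<approx> conj_word k [(w, True)]"
    using eq eqv_cong_iff[OF k(2,3)] by blast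
  then show uw: "u = w"
    using conj_word_eqv_iff[OF k(1)] letters_eqv by blast
  have "c @ d \<in> star_words u" "h \<approx> (c @ d) @ g" using cd uw by auto
  then show "\<exists>c\<in>star_words u. h \<approx> c @ g" by blast
qed

section \<open>Levels and the shears of the extension graph\<close>

definition centralizes :: "'v \<Rightarrow> 'v letter list \<Rightarrow> bool" where
  "centralizes v g \<longleftrightarrow> conj_word g [(v, True)] \<approx> [(v, True)]"

fun level :: "'v \<Rightarrow> 'v letter list \<Rightarrow> int" where
  "level v [] = 0"
| "level v (s # g) =
    (if fst s = v \<and> centralizes v g then (if snd s then 1 else - 1) else 0) + level v g"

lemma centralizes_cong: "a \<approx> b \<Longrightarrow> centralizes v a = centralizes v b"
  unfolding centralizes_def
  using conj_word_cong[OF _ eqv_refl, of a b "[(v, True)]"] eqv_sym eqv_trans by blast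

lemma centralizes_star_append:
  assumes "v \<in> V" "c \<in> star_words v"
  shows "centralizes v (c @ g) = centralizes v g"
proof -
  have "conj_word (c @ g) [(v, True)] \<approx> conj_word g [(v, True)]"
    unfolding conj_word_append using conj_star_word[OF assms] by (intro conj_word_cong) auto
  then show ?thesis
    unfolding centralizes_def using eqv_sym eqv_trans by blast
qed

lemma centralizes_Cons:
  "v \<in> V \<Longrightarrow> fst s \<in> star V E v \<Longrightarrow> centralizes v (s # g) = centralizes v g"
  using centralizes_star_append[of v "[s]" g] by (simp add: mem_Times_iff)

text \<open>The contribution of a letter of \<open>u\<close> depends only on the group element that
  follows it.\<close>

lemma level_append_diff: "a \<approx> b \<Longrightarrow> level v (u @ a) - level v (u @ b) = level v a - level v b"
proof (induction u)
  case (Cons s u)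
  have "centralizes v (u @ a) = centralizes v (u @ b)"
    using Cons.prems by (intro centralizes_cong eqv_append) auto
  then show ?case using Cons by simp
qed simp

text \<open>A cancelling pair contributes opposite signs. Swapping commuting letters changes the
  suffix of a letter \<open>v\<close> only by a letter in the star of \<open>v\<close>, which does
  not affect centralizing.\<close>

lemma level_cong:
  assumes v: "v \<in> V" and "a \<approx> b"
  shows "level v a = level v b"
proof (rule eqv_invariant[where F = "level v", OF _ assms(2)])
  fix a b assume st: "(a, b) \<in> raag_step V E"
  then show "level v a = level v b"
  proof cases
    case (cancel x u w)
    have "[x, linv x] @ w \<approx> w"
      using eqv_append[OF cancel_letter(1) eqv_refl, of x w] cancel by simp
    then have "level v a - level v b = level v ([x, linv x] @ w) - level v w"
      unfolding cancel by (rule level_append_diff)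
    moreover have "fst x = v \<Longrightarrow> centralizes v (linv x # w) = centralizes v w"
      using v by (intro centralizes_Cons) (simp_all add: star_iff)
    ultimately show ?thesis by (auto split: if_splits)
  next
    case (comm x y u w)
    have "[x, y] @ w \<approx> [y, x] @ w"
      using eqv_step[OF raag_step.comm[of x V y E "[]" w]] comm by simp
    then have "level v a - level v b = level v ([x, y] @ w) - level v ([y, x] @ w)"
      unfolding comm by (rule level_append_diff)
    moreover have "fst x = v \<Longrightarrow> centralizes v (y # w) = centralizes v w"
      using comm by (intro centralizes_Cons) (simp_all add: star_iff)
    moreover have "fst y = v \<Longrightarrow> centralizes v (x # w) = centralizes v w"
      using comm E_sym by (intro centralizes_Cons) (simp_all add: star_iff)
    ultimately show ?thesis by (auto split: if_splits)
  qed
qed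

text \<open>Multiplying on the right by an element that centralizes \<open>v\<close> does not change
  which suffixes centralize \<open>v\<close>.\<close>

lemma level_append_centralizes:
  assumes p: "p \<in> W" and c: "centralizes v p"
  shows "level v (g @ p) = level v g + level v p"
proof (induction g)
  case (Cons s g)
  have "conj_word (g @ p) [(v, True)] \<approx> [(v, True)] \<longleftrightarrow>
      conj_word p (conj_word g [(v, True)]) \<approx> conj_word p [(v, True)]"
    unfolding conj_word_append using c eqv_sym eqv_trans unfolding centralizes_def by meson
  then have "centralizes v (g @ p) = centralizes v g"
    unfolding centralizes_def conj_word_eqv_iff[OF p] .
  then show ?case using Cons by simp
qed simp

text \<open>A letter \<open>v\<close> of \<open>c\<close> that counted would be followed by an
  element fixing \<open>v\<close>. Conjugating the commuting pair \<open>v\<close>, \<open>u\<close>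
  by that element would make \<open>v\<close> commute with the conjugate of \<open>u\<close> by
  \<open>k\<close>.\<close>

lemma level_star_append:
  assumes u: "u \<in> V" and v: "v \<in> V" and k: "k \<in> W" and c: "c \<in> star_words u"
    and n: "\<not> commutes (conj_word k [(u, True)]) [(v, True)]"
  shows "level v (c @ k) = level v k"
  using c
proof (induction c)
  case (Cons s c)
  have False if s: "fst s = v" and z: "centralizes v (c @ k)"
  proof -
    have c: "c \<in> star_words u" using Cons by simp
    have "commutes [(v, True)] [(u, True)]"
      using Cons s u by (intro commutes_star_letter) auto
    then have "commutes (conj_word (c @ k) [(u, True)]) (conj_word (c @ k) [(v, True)])"
      using k star_words_W[OF c] commutes_sym by (intro commutes_conj_imp) auto
    moreover have "conj_word (c @ k) [(u, True)] \<approx> conj_word k [(u, True)]"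
      unfolding conj_word_append using conj_star_word[OF u c] by (intro conj_word_cong) auto
    ultimately show False
      using n z commutes_cong unfolding centralizes_def by blast
  qed
  then show ?case using Cons by auto
qed simp

section \<open>Powers of generators and of vertices\<close>

definition gpow :: "'v \<Rightarrow> int \<Rightarrow> 'v letter list" where
  "gpow v k = replicate (nat \<bar>k\<bar>) (v, 0 \<le> k)"

lemma gpow_0 [simp]: "gpow v 0 = []"
  unfolding gpow_def by simp

lemma gpow_unfold: "k > 0 \<Longrightarrow> gpow v k = (v, True) # gpow v (k - 1)"
  "k < 0 \<Longrightarrow> gpow v k = (v, False) # gpow v (k + 1)"
proof -
  assume "k > 0"
  then have "nat \<bar>k\<bar> = Suc (nat \<bar>k - 1\<bar>)" by simp
  then show "gpow v k = (v, True) # gpow v (k - 1)"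
    using \<open>k > 0\<close> unfolding gpow_def by simp
next
  assume "k < 0"
  then have "nat \<bar>k\<bar> = Suc (nat \<bar>k + 1\<bar>)" by simp
  then show "gpow v k = (v, False) # gpow v (k + 1)"
    using \<open>k < 0\<close> unfolding gpow_def by (cases "k = -1") simp_all
qed

lemma gpow_W [simp]: "v \<in> V \<Longrightarrow> gpow v k \<in> W"
  unfolding gpow_def by auto

lemma gpow_star_words: "v \<in> V \<Longrightarrow> gpow v k \<in> star_words v"
  unfolding gpow_def by (auto simp: star_iff)

lemma gpow_Cons:
  assumes "v \<in> V"
  shows "(v, b) # gpow v k \<approx> gpow v (k + (if b then 1 else - 1))"
proof -
  have c: "[(v, b), (v, \<not> b)] @ w \<approx> w" for w b
    using eqv_append[OF cancel_letter(1)[of "(v, b)"] eqv_refl[of w]] assms by simp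
  show ?thesis
  proof (cases b)
    case True
    show ?thesis
    proof (cases "k \<ge> 0")
      case True
      then show ?thesis using gpow_unfold(1)[of "k + 1" v] \<open>b\<close> by simp
    next
      case False
      then show ?thesis using gpow_unfold(2)[of k v] \<open>b\<close> c[of True "gpow v (k + 1)"] by simp
    qed
  next
    case False
    show ?thesis
    proof (cases "k \<le> 0")
      case True
      then show ?thesis using gpow_unfold(2)[of "k - 1" v] \<open>\<not> b\<close> by simp
    next
      case False
      then show ?thesis using gpow_unfold(1)[of k v] \<open>\<not> b\<close> c[of False "gpow v (k - 1)"] by simp
    qed
  qed
qed

lemma gpow_add:
  assumes "v \<in> V"
  shows "gpow v k @ gpow v m \<approx> gpow v (k + m)"
proof -
  have *: "replicate n (v, b) @ gpow v m \<approx> gpow v ((if b then int n else - int n) + m)" for n b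
  proof (induction n)
    case (Suc n)
    have "replicate (Suc n) (v, b) @ gpow v m \<approx>
        (v, b) # gpow v ((if b then int n else - int n) + m)"
      using eqv_Cons[OF Suc] by simp
    then show ?case
      using eqv_trans[OF _ gpow_Cons[OF assms, of b "(if b then int n else - int n) + m"]]
      by (cases b) (simp_all add: algebra_simps)
  qed simp
  show ?thesis
    using *[of "nat \<bar>k\<bar>" "0 \<le> k"] unfolding gpow_def[of v k] by (simp split: if_splits)
qed

lemma centralizes_star: "v \<in> V \<Longrightarrow> c \<in> star_words v \<Longrightarrow> centralizes v c"
  unfolding centralizes_def by (rule conj_star_word)

lemma level_gpow:
  assumes "v \<in> V"
  shows "level v (gpow v k) = k"
proof -
  have "level v (replicate n (v, b)) = (if b then int n else - int n)" for n b
  proof (induction n)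
    case (Suc n)
    have "centralizes v (replicate n (v, b))"
      using assms by (intro centralizes_star) (auto simp: star_iff)
    then show ?case using Suc by simp
  qed simp
  then show ?thesis unfolding gpow_def by simp
qed

lemma level_append_gpow: "v \<in> V \<Longrightarrow> level v (g @ gpow v k) = level v g + k"
  using level_append_centralizes[of "gpow v k" v g] centralizes_star gpow_star_words level_gpow by simp

lemma conj_gpow:
  assumes v: "v \<in> V" and "commutes a [(v, True)]"
  shows "conj_word (gpow v k) a \<approx> a"
proof -
  have 1: "conj_word [(v, True)] a \<approx> a"
    using assms commutes_iff_conj[of "[(v, True)]" a] commutes_sym by simp
  have "conj_word [(v, False)] (conj_word [(v, True)] a) \<approx> conj_word [(v, False)] a"
    using 1 by (rule conj_word_cong[OF eqv_refl])
  moreover have "conj_word [(v, False)] (conj_word [(v, True)] a) \<approx> a"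
    using conj_word_winv[of "[(v, True)]" a] v by simp
  ultimately have 2: "conj_word [(v, False)] a \<approx> a"
    using eqv_sym eqv_trans by blast
  have 3: "conj_word [(v, b)] a \<approx> a" for b
    using 1 2 by (cases b) simp_all
  have "conj_word (replicate n (v, b)) a \<approx> a" for n b
  proof (induction n)
    case (Suc n)
    have "conj_word ([(v, b)] @ replicate n (v, b)) a \<approx> conj_word (replicate n (v, b)) a"
      unfolding conj_word_append using 3 by (intro conj_word_cong) auto
    then have "conj_word ([(v, b)] @ replicate n (v, b)) a \<approx> a"
      using Suc by (rule eqv_trans)
    then show ?case by simp
  qed simp
  then show ?thesis unfolding gpow_def .
qed

text \<open>The \<open>k\<close>-th power of the conjugate of \<open>v\<close> by \<open>q\<close>;
  conjugation by it is the shear at that vertex.\<close>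

definition zpow :: "'v \<Rightarrow> 'v letter list \<Rightarrow> int \<Rightarrow> 'v letter list" where
  "zpow v q k = conj_word q (gpow v k)"

lemma zpow_W [simp]: "v \<in> V \<Longrightarrow> q \<in> W \<Longrightarrow> zpow v q k \<in> W"
  unfolding zpow_def conj_word_def using gpow_W[of v k] winv_W[of q] by (simp del: in_lists_conv_set winv_W)

lemma zpow_0: "q \<in> W \<Longrightarrow> zpow v q 0 \<approx> []"
  unfolding zpow_def conj_word_def using winv_left by simp

lemma zpow_add:
  assumes "v \<in> V" "q \<in> W"
  shows "zpow v q k @ zpow v q m \<approx> zpow v q (k + m)"
proof -
  have "zpow v q k @ zpow v q m \<approx> winv q @ (gpow v k @ gpow v m) @ q"
    using cancel_mid(2)[OF assms(2), of "winv q @ gpow v k" "gpow v m @ q"]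
    unfolding zpow_def conj_word_def by simp
  also have "winv q @ (gpow v k @ gpow v m) @ q \<approx> zpow v q (k + m)"
    unfolding zpow_def conj_word_def using gpow_add[OF assms(1)] by (rule eqv_context)
  finally show ?thesis .
qed

text \<open>In the coordinate \<open>g @ winv q\<close>, multiplying by a power of the vertex
  becomes multiplying by a power of the generator, which shifts levels.\<close>

lemma zpow_append_winv:
  assumes "v \<in> V" "q \<in> W"
  shows "(g @ zpow v q k) @ winv q \<approx> (g @ winv q) @ gpow v k"
  using cancel_mid(2)[OF assms(2), of "g @ winv q @ gpow v k" "[]"]
  unfolding zpow_def conj_word_def by simp

lemma level_zpow:
  "v \<in> V \<Longrightarrow> q \<in> W \<Longrightarrow> level v ((g @ zpow v q k) @ winv q) = level v (g @ winv q) + k"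
  using level_cong[OF _ zpow_append_winv] level_append_gpow by metis

section \<open>The extension graph and conjugation on its vertices\<close>

abbreviation "cls \<equiv> raag_elem V E"
abbreviation "X \<equiv> ext_vertices V E"
abbreviation "adj \<equiv> ext_adj V E"

definition vertex :: "'v \<Rightarrow> 'v letter list \<Rightarrow> 'v letter list set" where
  "vertex v q = cls (conj_word q [(v, True)])"

text \<open>On equivalence classes the choice of representative is immaterial by
  \<open>translate_cls\<close>.\<close>

definition translate :: "'v letter list \<Rightarrow> 'v letter list set \<Rightarrow> 'v letter list set" where
  "translate p y = cls (conj_word p (SOME a. a \<in> y))"

lemma cls_iff: "a \<in> cls b \<longleftrightarrow> a \<approx> b"
  unfolding raag_elem_def using eqv_sym by blast

lemma cls_eq_iff: "cls a = cls b \<longleftrightarrow> a \<approx> b"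
  using cls_iff eqv_sym eqv_trans eqv_refl by blast

lemma X_eq: "X = {vertex v q |v q. v \<in> V \<and> q \<in> W}"
  unfolding ext_vertices_def vertex_def conj_word_def ..

lemma vertex_X: "v \<in> V \<Longrightarrow> q \<in> W \<Longrightarrow> vertex v q \<in> X"
  unfolding X_eq by blast

lemma X_cases:
  assumes "y \<in> X"
  obtains v q where "y = vertex v q" "v \<in> V" "q \<in> W"
  using assms unfolding X_eq by blast

lemma vertex_cong: "g \<approx> h \<Longrightarrow> vertex u g = vertex u h"
  unfolding vertex_def cls_eq_iff by (intro conj_word_cong eqv_refl)

lemma adj_cls: "adj (cls a) (cls b) \<longleftrightarrow> \<not> a \<approx> b \<and> commutes a b"
  unfolding ext_adj_def cls_eq_iff using commutes_cong cls_iff eqv_sym eqv_refl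
  unfolding commutes_def by meson

lemma vertex_star_iff:
  assumes "u \<in> V" "g \<in> W"
  shows "vertex u g \<in> star X adj (vertex v q) \<longleftrightarrow>
    commutes (conj_word g [(u, True)]) (conj_word q [(v, True)])"
proof -
  let ?a = "conj_word g [(u, True)]" and ?b = "conj_word q [(v, True)]"
  have "commutes ?b ?a \<longleftrightarrow> commutes ?a ?b" "?b \<approx> ?a \<longleftrightarrow> ?a \<approx> ?b" "?a \<approx> ?b \<longrightarrow> commutes ?a ?b"
    using commutes_sym eqv_sym eqv_commutes by blast+
  then show ?thesis
    using vertex_X[OF assms] by (auto simp add: star_def vertex_def adj_cls cls_eq_iff)
qed

lemma translate_cls: "translate p (cls a) = cls (conj_word p a)"
proof -
  have "(SOME b. b \<in> cls a) \<in> cls a"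
    using someI[of "\<lambda>b. b \<in> cls a" a] cls_iff by blast
  then show ?thesis
    unfolding translate_def cls_eq_iff cls_iff by (intro conj_word_cong eqv_refl)
qed

lemma translate_vertex: "translate p (vertex u g) = vertex u (g @ p)"
  unfolding vertex_def translate_cls conj_word_append ..

lemma translate_adj: "p \<in> W \<Longrightarrow> adj (translate p (cls a)) (translate p (cls b)) = adj (cls a) (cls b)"
  unfolding translate_cls adj_cls conj_word_eqv_iff commutes_conj ..

lemma translate_star:
  assumes v: "v \<in> V" and q: "q \<in> W" and y: "y \<in> star X adj (vertex v q)"
  shows "translate (zpow v q k) y = y"
proof -
  obtain u g where u: "y = vertex u g" "u \<in> V" "g \<in> W"
    using y X_cases unfolding star_def by blast
  define a where "a = conj_word g [(u, True)]"
  \<comment> \<open>Conjugating by \<open>winv q\<close> turns the center into the generator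
    \<open>v\<close>, whose powers fix whatever commutes with it.\<close>
  define b where "b = conj_word (winv q) a"
  have "commutes a (conj_word q [(v, True)])"
    using y u vertex_star_iff unfolding a_def by blast
  then have "commutes b (conj_word (winv q) (conj_word q [(v, True)]))"
    unfolding b_def using q commutes_conj by simp
  then have "commutes b [(v, True)]"
    using commutes_cong[OF eqv_refl conj_word_winv[OF q]] by blast
  then have "conj_word q (conj_word (gpow v k) b) \<approx> conj_word q b"
    using conj_word_cong[OF eqv_refl conj_gpow[OF v]] by blast
  moreover have "conj_word q b \<approx> a"
    unfolding b_def using conj_word_winv[of "winv q" a] q by simp
  moreover have "conj_word (zpow v q k) a = conj_word q (conj_word (gpow v k) b)"
    unfolding b_def zpow_def conj_word_append[symmetric] conj_word_def[of q "gpow v k"] by simp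
  ultimately have "conj_word (zpow v q k) a \<approx> a"
    using eqv_trans by metis
  then show ?thesis
    unfolding u vertex_def translate_cls cls_eq_iff a_def .
qed

text \<open>Two names of a vertex differ by a left factor in the star of its generator, and off the
  star of the center that factor adds no level.\<close>

lemma level_well_defined:
  assumes v: "v \<in> V" and q: "q \<in> W" and u: "u \<in> V" "g \<in> W" and w: "w \<in> V" "h \<in> W"
    and eq: "vertex u g = vertex w h" and n: "vertex u g \<notin> star X adj (vertex v q)"
  shows "level v (g @ winv q) = level v (h @ winv q)"
proof -
  have "conj_word g [(u, True)] \<approx> conj_word h [(w, True)]"
    using eq unfolding vertex_def cls_eq_iff .
  then obtain c where c: "c \<in> star_words u" "h \<approx> c @ g"
    using conjugate_generators_eqD(2)[OF u(1) w(1) u(2) w(2)] by blast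
  have "\<not> commutes (conj_word g [(u, True)]) (conj_word q [(v, True)])"
    using n vertex_star_iff u by blast
  then have "\<not> commutes (conj_word (winv q) (conj_word g [(u, True)])) (conj_word (winv q) (conj_word q [(v, True)]))"
    using commutes_conj[of "winv q"] q by simp
  then have "\<not> commutes (conj_word (g @ winv q) [(u, True)]) [(v, True)]"
    unfolding conj_word_append using commutes_cong[OF eqv_refl conj_word_winv[OF q]] by blast
  then have "level v (c @ (g @ winv q)) = level v (g @ winv q)"
    using u v q c by (intro level_star_append) auto
  moreover have "h @ winv q \<approx> c @ (g @ winv q)"
    using eqv_append[OF c(2) eqv_refl[of "winv q"]] by simp
  ultimately show ?thesis using level_cong[OF v] by metis
qed

text \<open>Independent of the chosen representative only off the star of \<open>vertex v q\<close>.\<close>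

definition vlevel :: "'v \<Rightarrow> 'v letter list \<Rightarrow> 'v letter list set \<Rightarrow> int" where
  "vlevel v q y = (SOME n. \<exists>u\<in>V. \<exists>g\<in>W. y = vertex u g \<and> n = level v (g @ winv q))"

lemma vlevel_eq:
  assumes "v \<in> V" "q \<in> W" "u \<in> V" "g \<in> W" "vertex u g \<notin> star X adj (vertex v q)"
  shows "vlevel v q (vertex u g) = level v (g @ winv q)"
proof -
  have "\<exists>w\<in>V. \<exists>h\<in>W. vertex u g = vertex w h \<and> vlevel v q (vertex u g) = level v (h @ winv q)"
    unfolding vlevel_def by (rule someI_ex) (use assms in blast)
  then show ?thesis using level_well_defined assms by metis
qed

lemma shear_vertex:
  assumes v: "v \<in> V" and q: "q \<in> W"
  shows "shear X adj (vertex v q) (\<lambda>k. translate (zpow v q k)) (vlevel v q)"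
proof -
  let ?st = "star X adj (vertex v q)"
  have closed: "translate (zpow v q k) y \<in> X" if y: "y \<in> X" for k y
  proof -
    obtain u g where u: "y = vertex u g" "u \<in> V" "g \<in> W" using y X_cases by blast
    have "g @ zpow v q k \<in> W"
      using u(3) zpow_W[OF v q] unfolding append_in_lists_conv by blast
    then show ?thesis unfolding u translate_vertex using u(2) by (intro vertex_X)
  qed
  have zero: "translate (zpow v q 0) y = y" if y: "y \<in> X" for y
  proof -
    obtain u g where u: "y = vertex u g" "u \<in> V" "g \<in> W" using y X_cases by blast
    have "g @ zpow v q 0 \<approx> g"
      using eqv_append[OF eqv_refl[of g] zpow_0[OF q, of v]] by simp
    then show ?thesis unfolding u translate_vertex by (rule vertex_cong)
  qed
  have add: "translate (zpow v q k) (translate (zpow v q m) y) = translate (zpow v q (k + m)) y"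
    if y: "y \<in> X" for k m y
  proof -
    obtain u g where u: "y = vertex u g" "u \<in> V" "g \<in> W" using y X_cases by blast
    have "g @ zpow v q m @ zpow v q k \<approx> g @ zpow v q (k + m)"
      using eqv_append[OF eqv_refl[of g] zpow_add[OF v q, of m k]] by (simp add: add.commute)
    then show ?thesis unfolding u translate_vertex using vertex_cong by simp
  qed
  have adj: "adj (translate (zpow v q k) y) (translate (zpow v q k) z) = adj y z"
    if "y \<in> X" "z \<in> X" for k y z
    using that X_cases translate_adj[OF zpow_W[OF v q]] unfolding vertex_def by metis
  have lev: "vlevel v q (translate (zpow v q k) y) = vlevel v q y + k"
    if y: "y \<in> X" "y \<notin> ?st" for k y
  proof -
    obtain u g where u: "y = vertex u g" "u \<in> V" "g \<in> W" using y X_cases by blast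
    have gz: "g @ zpow v q k \<in> W"
      using u(3) zpow_W[OF v q] unfolding append_in_lists_conv by blast
    \<comment> \<open>The star is fixed by all shears, so a translate inside it would already equal
      \<open>y\<close>.\<close>
    have "translate (zpow v q k) y \<notin> ?st"
    proof
      assume "translate (zpow v q k) y \<in> ?st"
      then have "translate (zpow v q (- k)) (translate (zpow v q k) y) = translate (zpow v q k) y"
        using translate_star[OF v q] by blast
      moreover have "translate (zpow v q (- k)) (translate (zpow v q k) y) = y"
        using add[OF y(1), of "- k" k] zero[OF y(1)] by simp
      ultimately show False using y \<open>translate (zpow v q k) y \<in> ?st\<close> by simp
    qed
    then have "vlevel v q (translate (zpow v q k) y) = level v ((g @ zpow v q k) @ winv q)"
      unfolding u translate_vertex using vlevel_eq[OF v q u(2) gz] by blast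
    also have "\<dots> = level v (g @ winv q) + k" using level_zpow[OF v q] .
    also have "level v (g @ winv q) = vlevel v q y"
      using vlevel_eq[OF v q u(2,3)] y u by simp
    finally show ?thesis .
  qed
  have leq: "vlevel v q y = vlevel v q z"
    if y: "y \<in> X" "y \<notin> ?st" and z: "z \<in> X" "z \<notin> ?st" and a: "adj y z" for y z
  proof -
    obtain u g where u: "y = vertex u g" "u \<in> V" "g \<in> W" using y X_cases by blast
    obtain w h where w: "z = vertex w h" "w \<in> V" "h \<in> W" using z X_cases by blast
    have com: "commutes (conj_word g [(u, True)]) (conj_word h [(w, True)])"
      using a unfolding u w vertex_def adj_cls by blast
    \<comment> \<open>Adjacent vertices can be named by the same conjugator, so both levels are read
      off the same word.\<close>
    obtain k where k: "k \<in> W" "conj_word g [(u, True)] \<approx> conj_word k [(u, True)]"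
      "conj_word h [(w, True)] \<approx> conj_word k [(w, True)]"
      using common_conjugator[OF u(2) w(2) u(3) w(3) com] by blast
    have "y = vertex u k" "z = vertex w k"
      using k unfolding u w vertex_def cls_eq_iff by blast+
    then show ?thesis
      using vlevel_eq[OF v q u(2) k(1)] vlevel_eq[OF v q w(2) k(1)] y z by simp
  qed
  show ?thesis
    unfolding shear_def using closed zero add adj lev leq translate_star[OF v q] by auto
qed

section \<open>Folding connected families of chambers\<close>

text \<open>Fixes one word per group element, so that counting such words counts group
  elements.\<close>

definition nf :: "'v letter list \<Rightarrow> 'v letter list" where
  "nf g = (SOME h. h \<approx> g)"

lemma nf_eqv: "nf g \<approx> g"
  unfolding nf_def by (rule someI[of _ g]) simp

lemma nf_cong: "g \<approx> h \<Longrightarrow> nf g = nf h"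
proof -
  assume "g \<approx> h"
  then have "(\<lambda>k. k \<approx> g) = (\<lambda>k. k \<approx> h)"
    using eqv_cong_iff[OF eqv_refl] by blast
  then show ?thesis unfolding nf_def by simp
qed

lemma nf_nf [simp]: "nf (nf g) = nf g"
  using nf_cong nf_eqv by blast

lemma nf_W: "g \<in> W \<Longrightarrow> nf g \<in> W"
  using eqv_W[OF nf_eqv, of g] by blast

text \<open>The conjugate by \<open>g\<close> of the copy of the defining graph formed by the
  generators.\<close>

definition chamber :: "'v letter list \<Rightarrow> 'v letter list set set" where
  "chamber g = (\<lambda>u. vertex u g) ` V"

lemma chamber_cong: "g \<approx> h \<Longrightarrow> chamber g = chamber h"
  unfolding chamber_def using vertex_cong by blast

lemma chamber_translate: "translate p ` chamber g = chamber (g @ p)"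
  unfolding chamber_def image_image translate_vertex ..

lemma chamber_X: "g \<in> W \<Longrightarrow> chamber g \<subseteq> X"
  unfolding chamber_def using vertex_X by blast

text \<open>Connectedness in the Cayley graph whose edges are left multiplications by letters.
  Phrased with cuts, it passes to images under maps that keep or collapse edges.\<close>

definition connected_words :: "'v letter list set \<Rightarrow> bool" where
  "connected_words S \<longleftrightarrow>
    (\<forall>A\<subseteq>S. A \<noteq> {} \<and> A \<noteq> S \<longrightarrow> (\<exists>a\<in>A. \<exists>b\<in>S - A. \<exists>s\<in>V \<times> UNIV. b \<approx> s # a))"

lemma connected_wordsE:
  assumes "connected_words S" "A \<subseteq> S" "A \<noteq> {}" "A \<noteq> S"
  obtains a b s where "a \<in> A" "b \<in> S" "b \<notin> A" "s \<in> V \<times> UNIV" "b \<approx> s # a"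
  using assms unfolding connected_words_def by (elim allE[of _ A]) blast

lemma connected_ball: "connected_words (nf ` {w \<in> W. length w \<le> n})"
  unfolding connected_words_def
proof (intro allI impI)
  let ?B = "nf ` {w \<in> W. length w \<le> n}"
  fix A assume A: "A \<subseteq> ?B" "A \<noteq> {} \<and> A \<noteq> ?B"
  show "\<exists>a\<in>A. \<exists>b\<in>?B - A. \<exists>s\<in>V \<times> UNIV. b \<approx> s # a"
  proof (rule ccontr)
    assume no: "\<not> ?thesis"
    have no_edge: "\<not> y \<approx> t # x" if "x \<in> A" "y \<in> ?B" "y \<notin> A" "t \<in> V \<times> UNIV" for x y t
      using no that by blast
    \<comment> \<open>Stripping first letters leads from \<open>w\<close> to the empty word inside
      the ball. Each step can be traversed both ways, so if no edge leaves \<open>A\<close>,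
      membership in \<open>A\<close> never changes.\<close>
    have const: "nf w \<in> A \<longleftrightarrow> nf [] \<in> A" if "w \<in> W" "length w \<le> n" for w
      using that
    proof (induction w)
      case (Cons s w)
      have s: "s \<in> V \<times> UNIV" "linv s \<in> V \<times> UNIV" "fst s \<in> V" using Cons.hyps by (simp_all add: mem_Times_iff)
      have B: "nf w \<in> ?B" "nf (s # w) \<in> ?B" using Cons.hyps Cons.prems by auto
      have 1: "nf (s # w) \<approx> s # nf w"
        using eqv_trans[OF nf_eqv eqv_Cons[OF eqv_sym[OF nf_eqv]]] .
      have "linv s # nf (s # w) \<approx> [linv s, s] @ w"
        using eqv_Cons[OF nf_eqv, of "linv s" "s # w"] by simp
      also have "[linv s, s] @ w \<approx> w"
        using eqv_append[OF cancel_letter(2)[OF s(3)] eqv_refl[of w]] by simp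
      also have "w \<approx> nf w" using eqv_sym[OF nf_eqv] .
      finally have 2: "nf w \<approx> linv s # nf (s # w)" by (rule eqv_sym)
      have "nf w \<in> A \<longleftrightarrow> nf (s # w) \<in> A"
        using no_edge[of "nf w" "nf (s # w)" s] no_edge[of "nf (s # w)" "nf w" "linv s"] 1 2 s(1,2) B
        by argo
      then show ?case using Cons by simp
    qed simp
    show False
    proof (cases "nf [] \<in> A")
      case True
      then have "nf w \<in> A" if "w \<in> W" "length w \<le> n" for w
        using const[OF that] by blast
      then have "?B \<subseteq> A" by blast
      then show False using A by simp
    next
      case False
      then have "nf w \<notin> A" if "w \<in> W" "length w \<le> n" for w
        using const[OF that] by blast
      then have "A = {}" using A(1) by blast
      then show False using A by simp
    qed
  qed
qed

lemma translate_eq_iff: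
  assumes "p \<in> W" "y \<in> X" "z \<in> X"
  shows "translate p y = translate p z \<longleftrightarrow> y = z" "adj (translate p y) (translate p z) = adj y z"
proof -
  obtain u g where u: "y = vertex u g" using assms X_cases by blast
  obtain w h where w: "z = vertex w h" using assms X_cases by blast
  show "translate p y = translate p z \<longleftrightarrow> y = z"
    unfolding u w vertex_def translate_cls cls_eq_iff conj_word_eqv_iff[OF assms(1)] ..
  show "adj (translate p y) (translate p z) = adj y z"
    unfolding u w vertex_def translate_adj[OF assms(1)] ..
qed

lemma centralizes_commutes_letter:
  assumes v: "v \<in> V" and p: "p \<in> W" and c: "centralizes v p" and s: "fst s = v"
  shows "s # p \<approx> p @ [s]"
proof -
  have "commutes p [(v, True)]"
    using c commutes_iff_conj[OF p] unfolding centralizes_def by blast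
  then have 1: "p @ [(v, True)] \<approx> [(v, True)] @ p" unfolding commutes_def .
  \<comment> \<open>Multiplying by the inverse of \<open>v\<close> on both sides carries the
    relation over to the inverse letter.\<close>
  have "[(v, False)] @ (p @ [(v, True)]) @ [(v, False)] \<approx> [(v, False)] @ ([(v, True)] @ p) @ [(v, False)]"
    using eqv_context[OF 1] .
  moreover have "[(v, False)] @ (p @ [(v, True)]) @ [(v, False)] \<approx> (v, False) # p"
    using eqv_append[OF eqv_refl[of "(v, False) # p"] cancel_letter(1)[of "(v, True)"]] v by simp
  moreover have "[(v, False)] @ ([(v, True)] @ p) @ [(v, False)] \<approx> p @ [(v, False)]"
    using eqv_append[OF cancel_letter(2)[of "(v, True)"] eqv_refl[of "p @ [(v, False)]"]] v by simp
  ultimately have 2: "(v, False) # p \<approx> p @ [(v, False)]"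
    using eqv_cong_iff by blast
  show ?thesis
  proof (cases "snd s")
    case True
    then have "s = (v, True)" using s by (simp add: prod_eq_iff)
    then show ?thesis using eqv_sym[OF 1] by simp
  next
    case False
    then have "s = (v, False)" using s by (simp add: prod_eq_iff)
    then show ?thesis using 2 by simp
  qed
qed

section \<open>Folding words onto height zero\<close>

context
  fixes v a
  assumes v: "v \<in> V" and a: "a \<in> W"
begin

text \<open>Measured after moving the center \<open>vertex v a\<close> to the generator
  \<open>v\<close>, in line with \<open>vlevel\<close>.\<close>

definition height :: "'v letter list \<Rightarrow> int" where
  "height h = level v (h @ winv a)"

definition fold_word :: "'v letter list \<Rightarrow> 'v letter list" where
  "fold_word h = nf (h @ zpow v a (- height h))"

lemma height_cong: "g \<approx> h \<Longrightarrow> height g = height h"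
  unfolding height_def using level_cong[OF v] eqv_append eqv_refl by blast

lemma fold_word_eqv: "fold_word h \<approx> h @ zpow v a (- height h)"
  unfolding fold_word_def by (rule nf_eqv)

lemma fold_word_nf: "h \<in> W \<Longrightarrow> fold_word h \<in> nf ` W"
  unfolding fold_word_def using zpow_W[OF v a] by (intro imageI) (simp only: append_in_lists_conv)

lemma fold_word_W: "h \<in> W \<Longrightarrow> fold_word h \<in> W"
  unfolding fold_word_def using zpow_W[OF v a] by (intro nf_W) (simp only: append_in_lists_conv)

lemma height_base: "height a = 0"
  unfolding height_def using level_cong[OF v winv_right[OF a]] by simp

lemma fold_word_base: "nf a = a \<Longrightarrow> fold_word a = a"
  unfolding fold_word_def height_base using nf_cong[of "a @ zpow v a 0" a]
    eqv_append[OF eqv_refl[of a] zpow_0[OF a, of v]] by simp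

lemma height_fold_word: "height (fold_word h) = 0"
  using height_cong[OF fold_word_eqv, of h] level_zpow[OF v a, of h "- height h"]
  unfolding height_def by simp

lemma unfold_word: "fold_word h @ zpow v a (height h) \<approx> h"
proof -
  have "fold_word h @ zpow v a (height h) \<approx> h @ zpow v a (- height h) @ zpow v a (height h)"
    using eqv_append[OF fold_word_eqv eqv_refl, of h "zpow v a (height h)"] by simp
  also have "h @ zpow v a (- height h) @ zpow v a (height h) \<approx> h @ zpow v a 0"
    using eqv_append[OF eqv_refl[of h] zpow_add[OF v a, of "- height h" "height h"]] by simp
  also have "h @ zpow v a 0 \<approx> h"
    using eqv_append[OF eqv_refl[of h] zpow_0[OF a, of v]] by simp
  finally show ?thesis .
qed

text \<open>An edge that changes the height slides its letter through the centralizing word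
  \<open>g @ winv a\<close> into the power of the vertex, which absorbs it. Any other edge keeps the
  height, so both ends are multiplied by the same power.\<close>

lemma fold_word_edge:
  assumes g: "g \<in> W" and s: "s \<in> V \<times> UNIV" and h: "h \<approx> s # g"
  shows "if fst s = v \<and> centralizes v (g @ winv a) then fold_word h = fold_word g
    else fold_word h \<approx> s # fold_word g"
proof (cases "fst s = v \<and> centralizes v (g @ winv a)")
  case True
  define \<delta> :: int where "\<delta> = (if snd s then 1 else - 1)"
  have hh: "height h = height g + \<delta>"
    using height_cong[OF h] True unfolding height_def \<delta>_def by simp
  have zp: "x @ zpow v a k = (x @ winv a) @ gpow v k @ a" for x k
    unfolding zpow_def conj_word_def by simp
  have gW: "g @ winv a \<in> W" using g a by simp
  have "h @ zpow v a (- height h) \<approx> (s # g) @ zpow v a (- height h)"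
    using h by (rule eqv_append[OF _ eqv_refl])
  also have "(s # g) @ zpow v a (- height h) = (s # (g @ winv a)) @ gpow v (- height h) @ a"
    unfolding zp by simp
  also have "(s # (g @ winv a)) @ gpow v (- height h) @ a \<approx> ((g @ winv a) @ [s]) @ gpow v (- height h) @ a"
    using centralizes_commutes_letter[OF v gW, of s] True by (intro eqv_append eqv_refl) blast
  also have "((g @ winv a) @ [s]) @ gpow v (- height h) @ a = (g @ winv a) @ (s # gpow v (- height h)) @ a"
    by simp
  also have "(g @ winv a) @ (s # gpow v (- height h)) @ a \<approx> (g @ winv a) @ gpow v (- height g) @ a"
  proof (rule eqv_context)
    have "s = (v, snd s)" using True by (simp add: prod_eq_iff)
    then show "s # gpow v (- height h) \<approx> gpow v (- height g)"
      using gpow_Cons[OF v, of "snd s" "- height h"] unfolding hh \<delta>_def by (simp split: if_splits)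
  qed
  also have "(g @ winv a) @ gpow v (- height g) @ a = g @ zpow v a (- height g)"
    unfolding zp by simp
  finally show ?thesis
    using nf_cong True unfolding fold_word_def by simp
next
  case False
  have hh: "height h = height g"
    using height_cong[OF h] False unfolding height_def by auto
  have "fold_word h \<approx> (s # g) @ zpow v a (- height g)"
    using eqv_trans[OF fold_word_eqv eqv_append[OF h eqv_refl]] unfolding hh .
  also have "(s # g) @ zpow v a (- height g) = s # (g @ zpow v a (- height g))"
    by simp
  also have "s # (g @ zpow v a (- height g)) \<approx> s # fold_word g"
    using eqv_Cons[OF eqv_sym[OF fold_word_eqv]] .
  finally show ?thesis unfolding if_not_P[OF False] .
qed

text \<open>Pull a cut back along the fold. An edge across it is not collapsed, because its ends
  fold to different sides.\<close>

lemma connected_fold: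
  assumes S: "S \<subseteq> W" and conn: "connected_words S"
  shows "connected_words (fold_word ` S)"
  unfolding connected_words_def
proof (intro allI impI)
  fix A' assume A': "A' \<subseteq> fold_word ` S" "A' \<noteq> {} \<and> A' \<noteq> fold_word ` S"
  define A where "A = {g \<in> S. fold_word g \<in> A'}"
  have "A \<subseteq> S" "A \<noteq> {}" "A \<noteq> S" using A' unfolding A_def by blast+
  then obtain g h s where e: "g \<in> A" "h \<in> S" "h \<notin> A" "s \<in> V \<times> UNIV" "h \<approx> s # g"
    using connected_wordsE[OF conn] by metis
  have gh: "fold_word g \<in> A'" "fold_word h \<in> fold_word ` S - A'"
    using e(1-3) unfolding A_def by auto
  have "g \<in> W" using e(1) S unfolding A_def by blast
  moreover have "fold_word h \<noteq> fold_word g" using gh by auto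
  ultimately have "fold_word h \<approx> s # fold_word g"
    using fold_word_edge[of g s h] e(4,5) by (simp split: if_splits)
  then show "\<exists>a\<in>A'. \<exists>b\<in>fold_word ` S - A'. \<exists>s\<in>V \<times> UNIV. b \<approx> s # a"
    using gh e(4) by (intro bexI)
qed

text \<open>Prepares \<open>embeds_union_translates\<close>: the folded chambers sit on level zero,
  and their translates by the heights cover the original ones.\<close>

lemma fold_chambers:
  assumes S: "S \<subseteq> W"
  defines "T \<equiv> \<Union>h\<in>fold_word ` S. chamber h"
  shows "T \<subseteq> X" "t \<in> T \<Longrightarrow> t \<notin> star X adj (vertex v a) \<Longrightarrow> vlevel v a t = 0"
    "(\<Union>h\<in>S. chamber h) \<subseteq> (\<Union>k\<in>height ` S. translate (zpow v a k) ` T)"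
proof -
  have TW: "h \<in> S \<Longrightarrow> fold_word h \<in> W" for h using S fold_word_W by blast
  show "T \<subseteq> X" unfolding T_def using chamber_X TW by blast
  show "vlevel v a t = 0" if t: "t \<in> T" "t \<notin> star X adj (vertex v a)"
  proof -
    obtain h u where h: "h \<in> S" "u \<in> V" "t = vertex u (fold_word h)"
      using t unfolding T_def chamber_def by blast
    then have "vlevel v a t = level v (fold_word h @ winv a)"
      using vlevel_eq[OF v a h(2) TW[OF h(1)]] t by blast
    then show ?thesis using height_fold_word[of h] unfolding height_def by simp
  qed
  show "(\<Union>h\<in>S. chamber h) \<subseteq> (\<Union>k\<in>height ` S. translate (zpow v a k) ` T)"
  proof (rule UN_least)
    fix h assume h: "h \<in> S"
    have "chamber h = translate (zpow v a (height h)) ` chamber (fold_word h)"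
      unfolding chamber_translate using chamber_cong[OF unfold_word] by simp
    also have "\<dots> \<subseteq> translate (zpow v a (height h)) ` T"
      unfolding T_def using h by (intro image_mono UN_upper imageI)
    also have "\<dots> \<subseteq> (\<Union>k\<in>height ` S. translate (zpow v a k) ` T)"
      using h by (intro UN_upper imageI)
    finally show "chamber h \<subseteq> (\<Union>k\<in>height ` S. translate (zpow v a k) ` T)" .
  qed
qed

end

section \<open>Universality of the doubling sequence\<close>

lemma sheared_ext_graph:
  assumes "finite V"
  shows "sheared_graph X adj"
proof
  have "countable (V \<times> W)"
    using assms by (intro countable_SIGMA countable_lists countable_finite finite_cartesian_product) simp_all
  moreover have "X = (\<lambda>(v, q). vertex v q) ` (V \<times> W)"
    unfolding X_eq by auto
  ultimately show "countable X" by simp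
  show "\<exists>\<tau> l. shear X adj x \<tau> l" if "x \<in> X" for x
    using X_cases[OF that] shear_vertex by metis
qed

lemma chambers_embed:
  fixes G c
  assumes V: "finite V"
    and G0: "G 0 = chamber []"
    and ds: "sheared_graph.doubling_sequence X adj G c"
    and S: "finite S" "S \<noteq> {}" "S \<subseteq> nf ` W" "connected_words S"
  shows "\<exists>j f. embeds adj (\<Union>h\<in>S. chamber h) (G j) f"
  using S
proof (induction "card S" arbitrary: S rule: less_induct)
  case less
  interpret sheared_graph X adj using sheared_ext_graph[OF V] .
  have SW: "S \<subseteq> W" using less.prems(3) image_subsetI[OF nf_W] by (rule subset_trans)
  obtain a where aS: "a \<in> S" using less.prems by blast
  have aW: "a \<in> W" and nfa: "nf a = a" using aS SW less.prems by auto
  show ?case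
  proof (cases "S = {a}")
    case True
    have wa: "winv a \<in> W" using aW by simp
    \<comment> \<open>A single chamber is carried back to the defining graph by the inverse of its
      word.\<close>
    have "translate (winv a) ` chamber a = chamber []"
      unfolding chamber_translate using chamber_cong[OF winv_right[OF aW]] .
    then have "embeds adj (chamber a) (G 0) (translate (winv a))"
      unfolding embeds_def G0 inj_on_def
      using translate_eq_iff[OF wa] subsetD[OF chamber_X[OF aW]] by (metis order_refl)
    then show ?thesis unfolding True by auto
  next
    case False
    \<comment> \<open>The cut at \<open>{a}\<close> yields a neighbour \<open>b\<close> of
      \<open>a\<close>; the letter on that edge gives the direction of the fold.\<close>
    obtain b s where b: "b \<in> S" "b \<noteq> a" "s \<in> V \<times> UNIV" "b \<approx> s # a"
    proof (rule connected_wordsE[OF less.prems(4), of "{a}"])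
      show "{a} \<subseteq> S" "{a} \<noteq> {}" "{a} \<noteq> S" using aS False by auto
    qed (use that in blast)
    define v where "v = fst s"
    have v: "v \<in> V" using b unfolding v_def by auto
    let ?F = "fold_word v a"
    \<comment> \<open>The word \<open>a @ winv a\<close> is trivial in the group, so the edge from
      \<open>a\<close> to \<open>b\<close> is of the collapsing kind and the family shrinks.\<close>
    have "centralizes v (a @ winv a)"
      using centralizes_cong[OF winv_right[OF aW]] by (simp add: centralizes_def)
    then have "?F b = ?F a"
      using fold_word_edge[OF v aW aW b(3,4)] unfolding v_def by simp
    then have "card (?F ` S) < card S"
      using card_image_le[OF less.prems(1), of ?F] eq_card_imp_inj_on[OF less.prems(1), of ?F]
        b aS unfolding inj_on_def by (metis le_neq_implies_less)
    moreover have "finite (?F ` S)" "?F ` S \<noteq> {}" using less.prems by auto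
    moreover have "?F ` S \<subseteq> nf ` W" using fold_word_nf[OF v aW] SW by blast
    moreover have "connected_words (?F ` S)"
      using connected_fold[OF v aW SW less.prems(4)] .
    ultimately obtain i f where f: "embeds adj (\<Union>h\<in>?F ` S. chamber h) (G i) f"
      using less.hyps[of "?F ` S"] by blast
    \<comment> \<open>\<open>a\<close> has height zero and survives the fold, so the center is among
      the folded vertices.\<close>
    have "a \<in> ?F ` S" using fold_word_base[OF v aW nfa] aS by force
    then have center: "vertex v a \<in> (\<Union>h\<in>?F ` S. chamber h)" (is "_ \<in> ?T")
      using v unfolding chamber_def by blast
    have "\<exists>j g. embeds adj (\<Union>k\<in>height v a ` S. translate (zpow v a k) ` ?T) (G j) g"
    proof (rule embeds_union_translates[OF ds shear_vertex[OF v aW]])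
      show "vlevel v a t = 0" if "t \<in> ?T" "t \<notin> star X adj (vertex v a)" for t
        using fold_chambers(2)[OF v aW SW that] .
    qed (use fold_chambers(1)[OF v aW SW] center f less.prems in simp_all)
    then show ?thesis
      using embeds_mono[OF _ fold_chambers(3)[OF v aW SW] order_refl] by blast
  qed
qed

end

theorem theorem1p1:
  fixes V :: "'v set" and E :: "'v \<Rightarrow> 'v \<Rightarrow> bool"
  assumes "finite V" and "V \<noteq> {}"
    and "\<forall>a\<in>V. \<forall>b\<in>V. E a b \<longrightarrow> E b a"
    and "\<forall>a\<in>V. \<not> E a a"
  shows "\<exists>G :: nat \<Rightarrow> 'v letter list set set.
           (\<forall>i. finite (G i) \<and> G i \<subseteq> ext_vertices V E) \<and>
           (\<forall>i. \<exists>v\<in>G i. graph_iso (double_verts (G i) (ext_adj V E) v)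
                                    (double_adj (G i) (ext_adj V E) v)
                                    (G (Suc i)) (ext_adj V E)) \<and>
           (\<forall>S. finite S \<and> S \<subseteq> ext_vertices V E \<longrightarrow>
              (\<exists>i T. T \<subseteq> G i \<and> graph_iso S (ext_adj V E) T (ext_adj V E)))"
proof -
  interpret raag V E
    using assms by unfold_locales auto
  interpret sheared_graph X adj
    using sheared_ext_graph[OF assms(1)] .
  \<comment> \<open>The initial graph is the copy of the defining graph; \<open>V\<close> being
    nonempty provides a first center.\<close>
  have ch: "finite (chamber [])" "chamber [] \<noteq> {}" "chamber [] \<subseteq> X"
    using assms chamber_X[of "[]"] unfolding chamber_def by auto
  obtain G c where G0: "G 0 = chamber []" and ds: "doubling_sequence G c"
    using doubling_sequence_ex[OF ch] by blast
  have G: "finite (G i) \<and> G i \<subseteq> X" for i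
    using sequence_finite[OF ds] sequence_subset[OF ds] by blast
  have dbl: "\<exists>v\<in>G i. graph_iso (double_verts (G i) adj v) (double_adj (G i) adj v) (G (Suc i)) adj" for i
    using double_step_iso[OF sequence_step[OF ds] center_mem[OF ds] sequence_subset[OF ds]]
      center_mem[OF ds] by blast
  have univ: "\<exists>i T. T \<subseteq> G i \<and> graph_iso S adj T adj" if S: "finite S" "S \<subseteq> X" for S
  proof -
    \<comment> \<open>Finitely many vertices lie in the chambers over one ball, and balls are
      connected.\<close>
    have "\<exists>n. S \<subseteq> (\<Union>h\<in>nf ` {w \<in> W. length w \<le> n}. chamber h)"
      using S
    proof (induction S rule: finite_induct)
      case (insert y S)
      then obtain n where n: "S \<subseteq> (\<Union>h\<in>nf ` {w \<in> W. length w \<le> n}. chamber h)" by auto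
      obtain u g where u: "y = vertex u g" "u \<in> V" "g \<in> W" using insert X_cases by blast
      have y: "y \<in> chamber (nf g)"
        using u chamber_cong[OF nf_eqv] unfolding chamber_def by blast
      let ?N = "nf ` {w \<in> W. length w \<le> max n (length g)}"
      have "nf g \<in> ?N"
        using u(3) by (intro imageI) simp
      then have "y \<in> (\<Union>h\<in>?N. chamber h)"
        using y by (rule UN_I)
      moreover have "(\<Union>h\<in>nf ` {w \<in> W. length w \<le> n}. chamber h) \<subseteq> (\<Union>h\<in>?N. chamber h)"
        by (intro UN_mono image_mono) auto
      ultimately have "insert y S \<subseteq> (\<Union>h\<in>?N. chamber h)"
        using n by (meson insert_subsetI subset_trans)
      then show ?case by blast
    qed simp
    then obtain n where n: "S \<subseteq> (\<Union>h\<in>nf ` {w \<in> W. length w \<le> n}. chamber h)" by blast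
    let ?B = "nf ` {w \<in> W. length w \<le> n}"
    have "finite {w \<in> W. length w \<le> n}"
      using finite_lists_length_le[of "V \<times> (UNIV :: bool set)" n] assms(1)
      by (simp add: lists_eq_set)
    then have fin: "finite ?B" by simp
    have "nf [] \<in> ?B" by (intro imageI) simp
    then have ne: "?B \<noteq> {}" by blast
    have sub: "?B \<subseteq> nf ` W" by blast
    obtain j f where "embeds adj (\<Union>h\<in>?B. chamber h) (G j) f"
      using chambers_embed[OF assms(1) G0 ds fin ne sub connected_ball] by blast
    then have "embeds adj S (G j) f" using embeds_mono[OF _ n order_refl] by blast
    then show ?thesis using embeds_iso[of adj S "G j" f] by blast
  qed
  show ?thesis
    using G dbl univ by (intro exI[of _ G] conjI allI impI) simp_all
qed

end
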